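(* Let $p\in(\omega/(\omega+\eta),1]$, $q\in(p,\infty]\cap[1,\infty]$ and $\beta,\gamma\in(\omega(1/p-1),\eta)$. If $H^{p,q}_{\mathrm{at}}(X)$ is regarded as a subspace of $(\mathcal G^\eta_0(\beta,\gamma))'$, then $H^{p,q}_{\mathrm{cw}}(X)=H^{p,q}_{\mathrm{at}}(X)$ with equal (quasi-)norms.
   Context: Setting. $(X,d,\mu)$ is a space of homogeneous type: $d:X\times X\to[0,\infty)$ is a quasi-metric ($d(x,y)=0$ iff $x=y$; $d(x,y)=d(y,x)$; $d(x,z)\le A_0[d(x,y)+d(y,z)]$ with $A_0\in[1,\infty)$); $B(x,r):=\{y\in X:\ d(x,y)<r\}$; $\tau B$ is the ball with the same center and $\tau$ times the radius; $\mu$ is a non-negative measure with $\mu(2B)\le C_{(\mu)}\mu(B)$ for all balls $B$, and $\omega:=\log_2C_{(\mu)}$ is the upper dimension. Standing assumptions: for each $x$ the balls $\{B(x,r)\}_{r>0}$ form a basis of open neighborhoods of $x$; $\mu$ is Borel regular (open sets are measurable and every set $A$ is contained in a Borel set $E$ with $\mu(A)=\mu(E)$); $\mu(B(x,r))\in(0,\infty)$; $\mu(\{x\})=0$ for all $x$; $\operatorname{diam}X=\infty$ (hence $\mu(X)=\infty$). Write $V_r(x):=\mu(B(x,r))$, $V(x,y):=\mu(B(x,d(x,y)))$. Dyadic points and the index $\eta$. Fix a small $\delta\in(0,1)$ (e.g. $\delta\le(2A_0)^{-10}$), constants $0<c_0\le C_0$ with $12A_0^3C_0\delta\le c_0$,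 and nested countable index sets $\mathcal A_k\subset\mathcal A_{k+1}$ ($k\in\mathbb Z$) with points $z_\alpha^k$ ($\alpha\in\mathcal A_k$, $z^{k+1}_\alpha=z^k_\alpha$ for $\alpha\in\mathcal A_k$) satisfying $d(z^k_\alpha,z^k_\beta)\ge c_0\delta^k$ for $\alpha\ne\beta$ and $\min_\alpha d(x,z^k_\alpha)\le C_0\delta^k$ for all $x\in X$. Put $\mathcal G_k:=\mathcal A_{k+1}\setminus\mathcal A_k$ and $y^k_\alpha:=z^{k+1}_\alpha$ for $\alpha\in\mathcal G_k$. The number $\eta\in(0,1)$ is the smoothness index of the Auscher–Hytönen construction: for this $\eta$, every ball $B(x,r)$ admits a function $\psi$ with $\chi_{B(x,r)}\le\psi\le\chi_{B(x,2A_0r)}$ and $|\psi(y)-\psi(z)|\le C[d(y,z)/r]^\eta$, and $L^2(X)$ has an orthonormal basis $\{\psi^k_\alpha:k\in\mathbb Z,\alpha\in\mathcal G_k\}$ of (real-valued) wavelets with $\int_X\psi^k_\alpha\,d\mu=0$, $|\psi^k_\alpha(x)|\le CV_{\delta^k}(y^k_\alpha)^{-1/2}\exp\{-\nu[d(y^k_\alpha,x)/\delta^k]^a\}$, and $|\psi^k_\alpha(x)-\psi^k_\alpha(y)|\le C[d(x,y)/\delta^k]^\eta V_{\delta^k}(y^k_\alpha)^{-1/2}\exp\{-\nu[d(y^k_\alpha,x)/\delta^k]^a\}$ if $d(x,y)\le\delta^k$, for some constants $C,\nu\in(0,\infty)$, $a\in(0,1]$. Test functions and distributions. For $x_1\in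 X$, $r\in(0,\infty)$, $\beta\in(0,1]$, $\gamma\in(0,\infty)$, $\mathcal G(x_1,r,\beta,\gamma)$ is the set of functions $f$ on $X$ for which there is $C>0$ with: (size) $|f(x)|\le C\frac1{V_r(x_1)+V(x_1,x)}\big[\frac r{r+d(x_1,x)}\big]^\gamma$ for all $x$; (regularity) $|f(x)-f(y)|\le C\big[\frac{d(x,y)}{r+d(x_1,x)}\big]^\beta\frac1{V_r(x_1)+V(x_1,x)}\big[\frac r{r+d(x_1,x)}\big]^\gamma$ whenever $d(x,y)\le(2A_0)^{-1}[r+d(x_1,x)]$; its norm is the infimum of such $C$. Fix $x_0\in X$ and set $\mathcal G(\beta,\gamma):=\mathcal G(x_0,1,\beta,\gamma)$. For $\beta,\gamma\in(0,\eta)$, $\mathcal G^\eta_0(\beta,\gamma)$ is the closure of $\mathcal G(\eta,\eta)$ in $\mathcal G(\beta,\gamma)$, with the norm of $\mathcal G(\beta,\gamma)$; $(\mathcal G^\eta_0(\beta,\gamma))'$ is its dual with the weak-$*$ topology. Atomic Hardy spaces. A function $a$ is a $(p,q)$-atom if there is a ball $B(x_0',r)$ with $\{x:a(x)\ne0\}\subset B(x_0',r)$, $\|a\|_{L^q(X)}\le[\mu(B(x_0',r))]^{1/q-1/p}$ and $\int_Xa\,d\mu=0$. For $\alpha\in(0,\infty)$, the Lipschitz space $\mathcal L_\alpha(X)$ consists of measurable $f$ with $\|f\|_{\mathcal L_\alpha(X)}:=\sup_{x\ne y}\frac{|f(x)-f(y)|}{[V(x,y)]^\alpha}<\infty$;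 $(\mathcal L_\alpha(X))'$ is its dual with the weak-$*$ topology. $H^{p,q}_{\mathrm{cw}}(X)$ is the subspace of $(\mathcal L_{1/p-1}(X))'$ if $p\in(0,1)$, or of $L^1(X)$ if $p=1$, of all $f=\sum_{j}\lambda_ja_j$ with $(p,q)$-atoms $a_j$ and $\lambda_j\in\mathbb C$, $\sum_j|\lambda_j|^p<\infty$, the series converging in $(\mathcal L_{1/p-1}(X))'$ if $p\in(0,1)$ or in $L^1(X)$ if $p=1$. $H^{p,q}_{\mathrm{at}}(X)$ is the set of $f\in(\mathcal G^\eta_0(\beta,\gamma))'$ of the form $f=\sum_{j}\lambda_ja_j$ with the same kind of atoms and coefficients, the series converging in $(\mathcal G^\eta_0(\beta,\gamma))'$. In both cases the (quasi-)norm is the infimum of $(\sum_j|\lambda_j|^p)^{1/p}$ over all such decompositions. Elements of the two spaces are identified by restricting a functional on $\mathcal L_{1/p-1}(X)$ to $\mathcal G^\eta_0(\beta,\gamma)\subset\mathcal L_{1/p-1}(X)$ (when $p<1$), or by viewing an $L^1$ function as a distribution via integration (when $p=1$). *)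

theory Defs
  imports "HOL-Analysis.Analysis" "HOL-Probability.Essential_Supremum"
begin

subsection \<open>Spaces of homogeneous type\<close>

definition qball :: "('a \<Rightarrow> 'a \<Rightarrow> real) \<Rightarrow> 'a \<Rightarrow> real \<Rightarrow> 'a set" where
  "qball d x r = {y. d x y < r}"

text \<open>The space \<open>X\<close> is the whole type. Its topology, the one of the type class, is tied to
  \<open>d\<close> by the two ball axioms, so \<open>borel\<close> is the Borel sigma-algebra
  of \<open>X\<close>. The sigma-algebra of \<open>M\<close> may be larger than the Borel one (for instance its completion).
  Borel regularity speaks about arbitrary sets and therefore uses the outer measure.\<close>

locale homogeneous_type =
  fixes M :: "'a::topological_space measure"
    and d :: "'a \<Rightarrow> 'a \<Rightarrow> real"
    and A0 Cmu :: real
  assumes d_nonneg: "d x y \<ge> 0"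
    and d_zero_iff: "d x y = 0 \<longleftrightarrow> x = y"
    and d_sym: "d x y = d y x"
    and A0_ge_1: "1 \<le> A0"
    and d_quasi_triangle: "d x u \<le> A0 * (d x y + d y u)"
    and open_qball: "r > 0 \<Longrightarrow> open (qball d x r)"
    and qball_basis: "open U \<Longrightarrow> x \<in> U \<Longrightarrow> \<exists>r>0. qball d x r \<subseteq> U"
    and space_M: "space M = UNIV"
    and borel_sets_M: "sets borel \<subseteq> sets M"
    and borel_regular: "\<exists>E\<in>sets borel. S \<subseteq> E \<and> outer_measure_of M S = emeasure M E"
    and emeasure_qball_pos: "r > 0 \<Longrightarrow> 0 < emeasure M (qball d x r)"
    and emeasure_qball_finite: "r > 0 \<Longrightarrow> emeasure M (qball d x r) < \<infinity>"
    and doubling: "r > 0 \<Longrightarrow> measure M (qball d x (2 * r)) \<le> Cmu * measure M (qball d x r)"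
    and emeasure_point: "emeasure M {x} = 0"
    and diam_infinite: "\<exists>x y. R < d x y"

definition Vr :: "'a measure \<Rightarrow> ('a \<Rightarrow> 'a \<Rightarrow> real) \<Rightarrow> real \<Rightarrow> 'a \<Rightarrow> real" where
  "Vr M d r x = measure M (qball d x r)"

definition Vd :: "'a measure \<Rightarrow> ('a \<Rightarrow> 'a \<Rightarrow> real) \<Rightarrow> 'a \<Rightarrow> 'a \<Rightarrow> real" where
  "Vd M d x y = measure M (qball d x (d x y))"

definition upper_dim :: "real \<Rightarrow> real" where
  "upper_dim Cmu = log 2 Cmu"

subsection \<open>Dyadic points and the smoothness index\<close>

locale dyadic_points =
  fixes d :: "'a \<Rightarrow> 'a \<Rightarrow> real"
    and A0 \<delta> c0 C0 :: real
    and A :: "int \<Rightarrow> 'i set"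
    and z :: "int \<Rightarrow> 'i \<Rightarrow> 'a"
  assumes delta: "0 < \<delta>" "\<delta> < 1"
    and c0_C0: "0 < c0" "c0 \<le> C0" "12 * A0 ^ 3 * C0 * \<delta> \<le> c0"
    and countable_A: "countable (A k)"
    and A_nested: "A k \<subseteq> A (k + 1)"
    and z_nested: "\<alpha> \<in> A k \<Longrightarrow> z (k + 1) \<alpha> = z k \<alpha>"
    and z_separated: "\<alpha> \<in> A k \<Longrightarrow> \<alpha>' \<in> A k \<Longrightarrow> \<alpha> \<noteq> \<alpha>' \<Longrightarrow> d (z k \<alpha>) (z k \<alpha>') \<ge> c0 * \<delta> powi k"
    and z_dense: "\<exists>\<alpha>\<in>A k. d x (z k \<alpha>) \<le> C0 * \<delta> powi k"

text \<open>Each \<open>f\<close> in the complex space \<open>L\<^sup>2\<close> is the unconditional \<open>L\<^sup>2\<close>-sum of its expansion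
  in the real-valued orthonormal system \<open>e\<close>.\<close>

definition orthonormal_basis_L2 :: "'a measure \<Rightarrow> 'j set \<Rightarrow> ('j \<Rightarrow> 'a \<Rightarrow> real) \<Rightarrow> bool" where
  "orthonormal_basis_L2 M I e \<longleftrightarrow>
     (\<forall>i\<in>I. e i \<in> borel_measurable M \<and> integrable M (\<lambda>x. (e i x)\<^sup>2)) \<and>
     (\<forall>i\<in>I. \<forall>j\<in>I. (LINT x|M. e i x * e j x) = (if i = j then 1 else 0)) \<and>
     (\<forall>f :: 'a \<Rightarrow> complex. f \<in> borel_measurable M \<and> integrable M (\<lambda>x. (norm (f x))\<^sup>2) \<longrightarrow>
        ((\<lambda>F. LINT x|M. (norm (f x -
              (\<Sum>i\<in>F. (LINT y|M. f y * of_real (e i y)) * of_real (e i x))))\<^sup>2) \<longlongrightarrow> 0)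
          (finite_subsets_at_top I))"

text \<open>The wavelets of generation \<open>k\<close> are indexed by \<open>A (k + 1) - A k\<close>, and the wavelet with
  index \<open>(k, \<alpha>)\<close> is centred at \<open>z (k + 1) \<alpha>\<close>.\<close>

locale smoothness_index =
  fixes M :: "'a::topological_space measure"
    and d :: "'a \<Rightarrow> 'a \<Rightarrow> real"
    and A0 \<delta> :: real
    and A :: "int \<Rightarrow> 'i set"
    and z :: "int \<Rightarrow> 'i \<Rightarrow> 'a"
    and \<eta> :: real
  assumes eta: "0 < \<eta>" "\<eta> < 1"
    and bumps: "\<exists>C>0. \<forall>x. \<forall>r>0. \<exists>\<phi> :: 'a \<Rightarrow> real.
        (\<forall>y. indicator (qball d x r) y \<le> \<phi> y \<and> \<phi> y \<le> indicator (qball d x (2 * A0 * r)) y) \<and>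
        (\<forall>y u. \<bar>\<phi> y - \<phi> u\<bar> \<le> C * (d y u / r) powr \<eta>)"
    and wavelets: "\<exists>\<psi> :: int \<times> 'i \<Rightarrow> 'a \<Rightarrow> real.
        orthonormal_basis_L2 M (SIGMA k:UNIV. A (k + 1) - A k) \<psi> \<and>
        (\<exists>C>0. \<exists>\<nu>>0. \<exists>a. 0 < a \<and> a \<le> 1 \<and> (\<forall>k. \<forall>\<alpha>\<in>A (k + 1) - A k.
           (LINT x|M. \<psi> (k, \<alpha>) x) = 0 \<and>
           (\<forall>x. \<bar>\<psi> (k, \<alpha>) x\<bar> \<le> C * Vr M d (\<delta> powi k) (z (k + 1) \<alpha>) powr (- 1 / 2)
                 * exp (- \<nu> * (d (z (k + 1) \<alpha>) x / \<delta> powi k) powr a)) \<and>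
           (\<forall>x y. d x y \<le> \<delta> powi k \<longrightarrow>
              \<bar>\<psi> (k, \<alpha>) x - \<psi> (k, \<alpha>) y\<bar> \<le> C * (d x y / \<delta> powi k) powr \<eta>
                 * Vr M d (\<delta> powi k) (z (k + 1) \<alpha>) powr (- 1 / 2)
                 * exp (- \<nu> * (d (z (k + 1) \<alpha>) x / \<delta> powi k) powr a))))"

subsection \<open>Duals\<close>

text \<open>For a space \<open>S\<close> of functions with (semi-)norm \<open>N\<close>, continuous linear functionals are
  represented as extensional functions on \<open>S\<close>, so that equality of functionals is HOL equality.
  The weak-* topology is the topology of pointwise convergence on \<open>S\<close>.\<close>

definition cont_dual ::
    "('a \<Rightarrow> complex) set \<Rightarrow> (('a \<Rightarrow> complex) \<Rightarrow> real) \<Rightarrow> (('a \<Rightarrow> complex) \<Rightarrow> complex) set" where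
  "cont_dual S N = {T \<in> extensional S.
     (\<forall>f\<in>S. \<forall>g\<in>S. T (\<lambda>x. f x + g x) = T f + T g) \<and>
     (\<forall>c. \<forall>f\<in>S. T (\<lambda>x. c * f x) = c * T f) \<and>
     (\<exists>C. \<forall>f\<in>S. norm (T f) \<le> C * N f)}"

definition weak_star_topology ::
    "('a \<Rightarrow> complex) set \<Rightarrow> (('a \<Rightarrow> complex) \<Rightarrow> real) \<Rightarrow> (('a \<Rightarrow> complex) \<Rightarrow> complex) topology" where
  "weak_star_topology S N = subtopology (product_topology (\<lambda>_. euclidean) S) (cont_dual S N)"

definition functional_of ::
    "'a measure \<Rightarrow> ('a \<Rightarrow> complex) set \<Rightarrow> ('a \<Rightarrow> complex) \<Rightarrow> ('a \<Rightarrow> complex) \<Rightarrow> complex" where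
  "functional_of M S h = (\<lambda>g\<in>S. LINT x|M. h x * g x)"

subsection \<open>Test functions\<close>

definition test_bound ::
    "'a measure \<Rightarrow> ('a \<Rightarrow> 'a \<Rightarrow> real) \<Rightarrow> 'a \<Rightarrow> real \<Rightarrow> real \<Rightarrow> 'a \<Rightarrow> real" where
  "test_bound M d x1 r \<gamma> x = 1 / (Vr M d r x1 + Vd M d x1 x) * (r / (r + d x1 x)) powr \<gamma>"

definition test_constants ::
    "'a measure \<Rightarrow> ('a \<Rightarrow> 'a \<Rightarrow> real) \<Rightarrow> real \<Rightarrow> 'a \<Rightarrow> real \<Rightarrow> real \<Rightarrow> real \<Rightarrow> ('a \<Rightarrow> complex) \<Rightarrow> real set" where
  "test_constants M d A0 x1 r \<beta> \<gamma> f = {C. 0 < C \<and>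
     (\<forall>x. norm (f x) \<le> C * test_bound M d x1 r \<gamma> x) \<and>
     (\<forall>x y. d x y \<le> (r + d x1 x) / (2 * A0) \<longrightarrow>
        norm (f x - f y) \<le> C * (d x y / (r + d x1 x)) powr \<beta> * test_bound M d x1 r \<gamma> x)}"

definition test_space ::
    "'a measure \<Rightarrow> ('a \<Rightarrow> 'a \<Rightarrow> real) \<Rightarrow> real \<Rightarrow> 'a \<Rightarrow> real \<Rightarrow> real \<Rightarrow> real \<Rightarrow> ('a \<Rightarrow> complex) set" where
  "test_space M d A0 x1 r \<beta> \<gamma> = {f. test_constants M d A0 x1 r \<beta> \<gamma> f \<noteq> {}}"

definition test_norm ::
    "'a measure \<Rightarrow> ('a \<Rightarrow> 'a \<Rightarrow> real) \<Rightarrow> real \<Rightarrow> 'a \<Rightarrow> real \<Rightarrow> real \<Rightarrow> real \<Rightarrow> ('a \<Rightarrow> complex) \<Rightarrow> real" where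
  "test_norm M d A0 x1 r \<beta> \<gamma> f = Inf (test_constants M d A0 x1 r \<beta> \<gamma> f)"

definition G0 ::
    "'a measure \<Rightarrow> ('a \<Rightarrow> 'a \<Rightarrow> real) \<Rightarrow> real \<Rightarrow> 'a \<Rightarrow> real \<Rightarrow> real \<Rightarrow> real \<Rightarrow> ('a \<Rightarrow> complex) set" where
  "G0 M d A0 x0 \<eta> \<beta> \<gamma> = {f \<in> test_space M d A0 x0 1 \<beta> \<gamma>.
     \<forall>\<epsilon>>0. \<exists>g\<in>test_space M d A0 x0 1 \<eta> \<eta>. test_norm M d A0 x0 1 \<beta> \<gamma> (\<lambda>x. f x - g x) < \<epsilon>}"

subsection \<open>Lipschitz spaces\<close>

definition Lip_quotients ::
    "'a measure \<Rightarrow> ('a \<Rightarrow> 'a \<Rightarrow> real) \<Rightarrow> real \<Rightarrow> ('a \<Rightarrow> complex) \<Rightarrow> real set" where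
  "Lip_quotients M d \<alpha> f = {norm (f x - f y) / Vd M d x y powr \<alpha> | x y. x \<noteq> y}"

definition Lip_space :: "'a measure \<Rightarrow> ('a \<Rightarrow> 'a \<Rightarrow> real) \<Rightarrow> real \<Rightarrow> ('a \<Rightarrow> complex) set" where
  "Lip_space M d \<alpha> = {f \<in> borel_measurable M. bdd_above (Lip_quotients M d \<alpha> f)}"

definition Lip_norm ::
    "'a measure \<Rightarrow> ('a \<Rightarrow> 'a \<Rightarrow> real) \<Rightarrow> real \<Rightarrow> ('a \<Rightarrow> complex) \<Rightarrow> real" where
  "Lip_norm M d \<alpha> f = Sup (Lip_quotients M d \<alpha> f)"

subsection \<open>Atoms and atomic Hardy spaces\<close>

definition Lq_space :: "'a measure \<Rightarrow> ennreal \<Rightarrow> ('a \<Rightarrow> complex) set" where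
  "Lq_space M q = {f \<in> borel_measurable M.
     if q = \<infinity> then esssup M (\<lambda>x. ennreal (norm (f x))) < \<infinity>
     else integrable M (\<lambda>x. norm (f x) powr enn2real q)}"

definition Lq_norm :: "'a measure \<Rightarrow> ennreal \<Rightarrow> ('a \<Rightarrow> complex) \<Rightarrow> real" where
  "Lq_norm M q f =
     (if q = \<infinity> then enn2real (esssup M (\<lambda>x. ennreal (norm (f x))))
      else (LINT x|M. norm (f x) powr enn2real q) powr (1 / enn2real q))"

text \<open>For \<open>q = \<infinity>\<close> the term \<open>enn2real (inverse q)\<close> is \<open>0\<close>, as it should be.\<close>

definition hardy_atom ::
    "'a measure \<Rightarrow> ('a \<Rightarrow> 'a \<Rightarrow> real) \<Rightarrow> real \<Rightarrow> ennreal \<Rightarrow> ('a \<Rightarrow> complex) \<Rightarrow> bool" where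
  "hardy_atom M d p q a \<longleftrightarrow> (\<exists>x r. 0 < r \<and> {y. a y \<noteq> 0} \<subseteq> qball d x r \<and>
     a \<in> Lq_space M q \<and>
     Lq_norm M q a \<le> measure M (qball d x r) powr (enn2real (inverse q) - 1 / p) \<and>
     (LINT y|M. a y) = 0)"

definition atomic_data ::
    "'a measure \<Rightarrow> ('a \<Rightarrow> 'a \<Rightarrow> real) \<Rightarrow> real \<Rightarrow> ennreal \<Rightarrow>
      (nat \<Rightarrow> complex) \<Rightarrow> (nat \<Rightarrow> 'a \<Rightarrow> complex) \<Rightarrow> bool" where
  "atomic_data M d p q l a \<longleftrightarrow>
     (\<forall>j. hardy_atom M d p q (a j)) \<and> summable (\<lambda>j. norm (l j) powr p)"

definition lp_quasinorm :: "real \<Rightarrow> (nat \<Rightarrow> complex) \<Rightarrow> real" where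
  "lp_quasinorm p l = (\<Sum>j. norm (l j) powr p) powr (1 / p)"

definition atomic_sum :: "(nat \<Rightarrow> complex) \<Rightarrow> (nat \<Rightarrow> 'a \<Rightarrow> complex) \<Rightarrow> nat \<Rightarrow> 'a \<Rightarrow> complex" where
  "atomic_sum l a n = (\<lambda>x. \<Sum>j<n. l j * a j x)"

definition weak_star_decomp ::
    "'a measure \<Rightarrow> ('a \<Rightarrow> 'a \<Rightarrow> real) \<Rightarrow> real \<Rightarrow> ennreal \<Rightarrow>
      ('a \<Rightarrow> complex) set \<Rightarrow> (('a \<Rightarrow> complex) \<Rightarrow> real) \<Rightarrow> (('a \<Rightarrow> complex) \<Rightarrow> complex) \<Rightarrow>
      (nat \<Rightarrow> complex) \<Rightarrow> (nat \<Rightarrow> 'a \<Rightarrow> complex) \<Rightarrow> bool" where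
  "weak_star_decomp M d p q S N T l a \<longleftrightarrow> atomic_data M d p q l a \<and>
     limitin (weak_star_topology S N) (\<lambda>n. functional_of M S (atomic_sum l a n)) T sequentially"

definition H_at ::
    "'a measure \<Rightarrow> ('a \<Rightarrow> 'a \<Rightarrow> real) \<Rightarrow> real \<Rightarrow> 'a \<Rightarrow> real \<Rightarrow> real \<Rightarrow> real \<Rightarrow> real \<Rightarrow> ennreal \<Rightarrow>
      (('a \<Rightarrow> complex) \<Rightarrow> complex) set" where
  "H_at M d A0 x0 \<eta> \<beta> \<gamma> p q =
     {T \<in> cont_dual (G0 M d A0 x0 \<eta> \<beta> \<gamma>) (test_norm M d A0 x0 1 \<beta> \<gamma>).
       \<exists>l a. weak_star_decomp M d p q (G0 M d A0 x0 \<eta> \<beta> \<gamma>) (test_norm M d A0 x0 1 \<beta> \<gamma>) T l a}"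

definition H_at_norm ::
    "'a measure \<Rightarrow> ('a \<Rightarrow> 'a \<Rightarrow> real) \<Rightarrow> real \<Rightarrow> 'a \<Rightarrow> real \<Rightarrow> real \<Rightarrow> real \<Rightarrow> real \<Rightarrow> ennreal \<Rightarrow>
      (('a \<Rightarrow> complex) \<Rightarrow> complex) \<Rightarrow> real" where
  "H_at_norm M d A0 x0 \<eta> \<beta> \<gamma> p q T = Inf {lp_quasinorm p l | l a.
     weak_star_decomp M d p q (G0 M d A0 x0 \<eta> \<beta> \<gamma>) (test_norm M d A0 x0 1 \<beta> \<gamma>) T l a}"

text \<open>The Coifman-Weiss space is a space of functionals for \<open>p < 1\<close> (\<open>H_cw\<close>), and for \<open>p = 1\<close>
  a space of integrable functions, representing their almost-everywhere classes (\<open>H_cw1\<close>).\<close>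

definition H_cw ::
    "'a measure \<Rightarrow> ('a \<Rightarrow> 'a \<Rightarrow> real) \<Rightarrow> real \<Rightarrow> ennreal \<Rightarrow> (('a \<Rightarrow> complex) \<Rightarrow> complex) set" where
  "H_cw M d p q =
     {T \<in> cont_dual (Lip_space M d (1 / p - 1)) (Lip_norm M d (1 / p - 1)).
       \<exists>l a. weak_star_decomp M d p q (Lip_space M d (1 / p - 1)) (Lip_norm M d (1 / p - 1)) T l a}"

definition H_cw_norm ::
    "'a measure \<Rightarrow> ('a \<Rightarrow> 'a \<Rightarrow> real) \<Rightarrow> real \<Rightarrow> ennreal \<Rightarrow> (('a \<Rightarrow> complex) \<Rightarrow> complex) \<Rightarrow> real" where
  "H_cw_norm M d p q T = Inf {lp_quasinorm p l | l a.
     weak_star_decomp M d p q (Lip_space M d (1 / p - 1)) (Lip_norm M d (1 / p - 1)) T l a}"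

definition L1_decomp ::
    "'a measure \<Rightarrow> ('a \<Rightarrow> 'a \<Rightarrow> real) \<Rightarrow> ennreal \<Rightarrow> ('a \<Rightarrow> complex) \<Rightarrow>
      (nat \<Rightarrow> complex) \<Rightarrow> (nat \<Rightarrow> 'a \<Rightarrow> complex) \<Rightarrow> bool" where
  "L1_decomp M d q f l a \<longleftrightarrow> atomic_data M d 1 q l a \<and>
     (\<lambda>n. LINT x|M. norm (f x - atomic_sum l a n x)) \<longlonglongrightarrow> 0"

definition H_cw1 ::
    "'a measure \<Rightarrow> ('a \<Rightarrow> 'a \<Rightarrow> real) \<Rightarrow> ennreal \<Rightarrow> ('a \<Rightarrow> complex) set" where
  "H_cw1 M d q = {f. integrable M f \<and> (\<exists>l a. L1_decomp M d q f l a)}"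

definition H_cw1_norm ::
    "'a measure \<Rightarrow> ('a \<Rightarrow> 'a \<Rightarrow> real) \<Rightarrow> ennreal \<Rightarrow> ('a \<Rightarrow> complex) \<Rightarrow> real" where
  "H_cw1_norm M d q f = Inf {lp_quasinorm 1 l | l a. L1_decomp M d q f l a}"

end

theory Submission
  imports Defs
begin

text \<open>Write \<open>\<alpha> = 1/p - 1\<close>. An atom pairs with an \<open>L\<^sub>\<alpha>\<close> function to at most its Lipschitz
  constant, because it has mean zero and \<open>L\<^sup>1\<close> norm at most \<open>\<mu>(B)\<^sup>-\<^sup>\<alpha>\<close>. As \<open>p \<le> 1\<close>, every atomic series
  therefore converges absolutely on \<open>L\<^sub>\<alpha>\<close> (in \<open>L\<^sup>1\<close> if \<open>p = 1\<close>), whichever weak-* topology it was taken in,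
  and test functions lie in \<open>L\<^sub>\<alpha>\<close> because \<open>\<beta> \<ge> \<omega>\<alpha>\<close>. So the theorem reduces to uniqueness: an atomic
  series that vanishes on the test functions is zero.

  For \<open>p < 1\<close>, an atomic series is continuous along pointwise convergent sequences with bounded
  Lipschitz constants, so it is enough to reach every real \<open>L\<^sub>\<alpha>\<close> function by such limits
  from constants plus boundedly supported \<open>\<eta>\<close>-Hoelder functions. These form a lattice, and
  a McShane-type formula writes an \<open>L\<^sub>\<alpha>\<close> function as an infimum of suprema of rescaled bump functions;
  the Lipschitz constants stay bounded because \<open>\<omega>\<alpha> \<le> \<eta>\<close>. For \<open>p = 1\<close>, finite maxima of bumps
  increase to the indicator of any open set, and Borel regularity does the rest.\<close>

subsection \<open>Volumes of balls\<close>

text \<open>The lower bound on p amounts to \<omega>\<alpha> < \<eta>. Doubling makes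
  V(x,y)^\<alpha> at least a multiple of (d(x,y)/R)^(\<omega>\<alpha>) V_R(x)^\<alpha> for d(x,y)
  \<le> R, so the smoothness orders \<beta> of test functions and \<eta> of bumps both suffice for
  Lipschitz estimates. Uniqueness does not go through density in the Lipschitz norm. Pointwise
  convergence with a common Lipschitz constant is enough for a single atom, by dominated convergence
  on its ball, and summability of the coefficients carries it over to the series. Maxima and minima
  suit this mode of convergence, since the Lipschitz constant does not grow with the number of
  functions, as it would for sums. The classical McShane functions f(u) + L V(u,x)^\<alpha> cannot
  be used directly: volumes of balls may jump with the radius, so they may be discontinuous in x.
  Suprema of rescaled bumps replace them. These are constant far away; nonzero constants are not
  test functions, but atoms do not see them. The norms agree because the same pairs of coefficients
  and atoms represent corresponding elements, so both infima range over the same set.\<close>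

definition lip_bound ::
    "'a measure \<Rightarrow> ('a \<Rightarrow> 'a \<Rightarrow> real) \<Rightarrow> real \<Rightarrow> real \<Rightarrow> ('a \<Rightarrow> 'b::real_normed_vector) \<Rightarrow> bool" where
  "lip_bound M d \<alpha> L f \<longleftrightarrow> (\<forall>x y. norm (f x - f y) \<le> L * Vd M d x y powr \<alpha>)"

context homogeneous_type
begin

abbreviation vol :: "'a \<Rightarrow> real \<Rightarrow> real" where
  "vol x r \<equiv> measure M (qball d x r)"

abbreviation \<omega> :: real where
  "\<omega> \<equiv> upper_dim Cmu"

lemma d_self [simp]: "d x x = 0"
  by (simp add: d_zero_iff)

lemma A0_pos: "0 < A0"
  using A0_ge_1 by linarith

lemma mem_qball: "y \<in> qball d x r \<longleftrightarrow> d x y < r"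
  by (simp add: qball_def)

lemma qball_mono: "r \<le> s \<Longrightarrow> qball d x r \<subseteq> qball d x s"
  by (auto simp: qball_def)

lemma qball_empty: "r \<le> 0 \<Longrightarrow> qball d x r = {}"
  by (auto simp: qball_def not_less intro: order_trans[OF _ d_nonneg])

lemma open_imp_sets: "open U \<Longrightarrow> U \<in> sets M"
  by (rule subsetD[OF borel_sets_M borel_open])

lemma sets_qball [measurable, simp]: "qball d x r \<in> sets M"
  by (cases "r > 0") (auto simp: open_imp_sets open_qball qball_empty)

lemma emeasure_qball: "emeasure M (qball d x r) = ennreal (vol x r)"
proof (cases "r > 0")
  case True
  then show ?thesis
    using emeasure_qball_finite[of r x] by (intro emeasure_eq_ennreal_measure) auto
qed (simp add: qball_empty)

lemma fmeasurable_qball [simp]: "qball d x r \<in> fmeasurable M"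
  by (simp add: fmeasurable_def emeasure_qball)

lemma vol_pos: "0 < r \<Longrightarrow> 0 < vol x r"
  using emeasure_qball_pos[of r x] by (simp add: emeasure_qball)

lemma vol_mono: "qball d x r \<subseteq> qball d y s \<Longrightarrow> vol x r \<le> vol y s"
  by (rule measure_mono_fmeasurable) simp_all

lemma vol_mono_radius: "r \<le> s \<Longrightarrow> vol x r \<le> vol x s"
  by (intro vol_mono qball_mono)

lemma Vd_eq: "Vd M d x y = vol x (d x y)"
  by (simp add: Vd_def)

lemma Vd_nonneg: "0 \<le> Vd M d x y"
  by (simp add: Vd_def)

lemma Vd_self [simp]: "Vd M d x x = 0"
  by (simp add: Vd_def qball_empty)

lemma d_pos: "x \<noteq> y \<Longrightarrow> 0 < d x y"
  using d_nonneg[of x y] d_zero_iff[of x y] by linarith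

lemma Vd_pos: "x \<noteq> y \<Longrightarrow> 0 < Vd M d x y"
  by (simp add: Vd_eq vol_pos d_pos)

lemma Cmu_ge_1: "1 \<le> Cmu"
proof -
  fix x :: 'a
  have "vol x 1 \<le> vol x (2 * 1)" by (rule vol_mono_radius) simp
  also have "\<dots> \<le> Cmu * vol x 1" by (rule doubling) simp
  finally show ?thesis using vol_pos[of 1 x] by simp
qed

lemma omega_nonneg: "0 \<le> \<omega>"
  using Cmu_ge_1 by (simp add: upper_dim_def)

lemma vol_doubling_iterate: "0 < r \<Longrightarrow> vol x (2 ^ n * r) \<le> Cmu ^ n * vol x r"
proof (induction n)
  case (Suc n)
  have "vol x (2 * (2 ^ n * r)) \<le> Cmu * vol x (2 ^ n * r)"
    using Suc.prems by (intro doubling) simp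
  also have "\<dots> \<le> Cmu * (Cmu ^ n * vol x r)"
    using Suc Cmu_ge_1 by (intro mult_left_mono) auto
  finally show ?case by (simp add: mult_ac)
qed simp

text \<open>Round \<open>log 2 t\<close> up to an integer and iterate doubling. The rounding costs
  the extra factor \<open>Cmu\<close>, and \<open>Cmu powr log 2 t\<close> is
  \<open>t powr \<omega>\<close>.\<close>

lemma vol_scale:
  assumes "0 < r" "1 \<le> t"
  shows "vol x (t * r) \<le> Cmu * t powr \<omega> * vol x r"
proof -
  define n where "n = nat \<lceil>log 2 t\<rceil>"
  have l: "0 \<le> log 2 t" using assms by simp
  then have n: "log 2 t \<le> real n" "real n \<le> log 2 t + 1" unfolding n_def by linarith+
  have "t = 2 powr (log 2 t)" using assms by simp
  also have "\<dots> \<le> 2 powr real n" using n by (intro powr_mono) auto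
  finally have t: "t \<le> 2 ^ n" by (simp add: powr_realpow)
  have "vol x (t * r) \<le> vol x (2 ^ n * r)"
    using t assms by (intro vol_mono_radius mult_right_mono) auto
  also have "\<dots> \<le> Cmu ^ n * vol x r" by (rule vol_doubling_iterate[OF assms(1)])
  also have "Cmu ^ n = Cmu powr real n" using Cmu_ge_1 by (simp add: powr_realpow)
  also have "Cmu powr real n \<le> Cmu powr (log 2 t + 1)" using n Cmu_ge_1 by (intro powr_mono) auto
  also have "Cmu powr (log 2 t + 1) = Cmu * Cmu powr (log 2 t)"
    using Cmu_ge_1 by (simp add: powr_add)
  also have "Cmu powr (log 2 t) = t powr \<omega>"
    using Cmu_ge_1 assms by (simp add: powr_def upper_dim_def log_def)
  finally show ?thesis by (simp add: mult_right_mono)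
qed

text \<open>A change of centre: the quasi-triangle inequality puts B(u,R) into the ball about x of
  radius \<open>A0 * (K + 1) * R\<close>, which is then shrunk to radius s. The maximum with 1
  covers the case where s is already the larger radius.\<close>

lemma vol_compare:
  assumes "0 < s" "0 < R" "0 \<le> K" "d x u \<le> K * R"
  shows "vol u R \<le> Cmu * max 1 (A0 * (K + 1) * R / s) powr \<omega> * vol x s"
proof -
  have "qball d u R \<subseteq> qball d x (A0 * (K + 1) * R)"
  proof
    fix y assume "y \<in> qball d u R"
    then have "d u y < R" by (simp add: mem_qball)
    then have "A0 * (d x u + d u y) < A0 * (K * R + R)"
      using assms A0_pos by (intro mult_strict_left_mono) auto
    with d_quasi_triangle[of x y u] show "y \<in> qball d x (A0 * (K + 1) * R)"
      by (simp add: mem_qball algebra_simps)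
  qed
  then have "vol u R \<le> vol x (A0 * (K + 1) * R)" by (rule vol_mono)
  also have "\<dots> \<le> vol x (max 1 (A0 * (K + 1) * R / s) * s)"
    using assms by (intro vol_mono_radius) (auto simp: max_def field_simps)
  also have "\<dots> \<le> Cmu * max 1 (A0 * (K + 1) * R / s) powr \<omega> * vol x s"
    using assms by (intro vol_scale) auto
  finally show ?thesis .
qed

section \<open>Continuity and measurability of Lipschitz functions\<close>

text \<open>The hypothesis is continuity, phrased with the balls of \<open>d\<close> because the
  type carries only a topology; preimages of open sets are then open, hence in
  \<open>sets M\<close>.\<close>

lemma measurable_if_locally_small:
  fixes f :: "'a \<Rightarrow> 'b::metric_space"
  assumes "\<And>x \<epsilon>. 0 < \<epsilon> \<Longrightarrow> \<exists>r>0. \<forall>y. d x y < r \<longrightarrow> dist (f y) (f x) < \<epsilon>"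
  shows "f \<in> borel_measurable M"
proof (rule borel_measurableI)
  fix S :: "'b set" assume S: "open S"
  have "open (f -` S)"
  proof (subst open_subopen, intro ballI)
    fix x assume "x \<in> f -` S"
    then obtain \<epsilon> where \<epsilon>: "\<epsilon> > 0" "\<And>y. dist y (f x) < \<epsilon> \<Longrightarrow> y \<in> S"
      using S by (auto simp: open_dist)
    obtain r where r: "r > 0" "\<And>y. d x y < r \<Longrightarrow> dist (f y) (f x) < \<epsilon>"
      using assms[OF \<epsilon>(1)] by blast
    show "\<exists>T. open T \<and> x \<in> T \<and> T \<subseteq> f -` S"
      using r \<epsilon> by (intro exI[of _ "qball d x r"]) (auto simp: open_qball mem_qball)
  qed
  then show "f -` S \<inter> space M \<in> sets M" by (simp add: space_M open_imp_sets)
qed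

text \<open>The balls of radius 1/(n+1) have finite measure and decrease to {x}, which is a null set
  by assumption.\<close>

lemma vol_tendsto_0:
  assumes "0 < \<epsilon>"
  shows "\<exists>r>0. vol x r < \<epsilon>"
proof -
  have "(\<lambda>n. vol x (inverse (real (Suc n)))) \<longlonglongrightarrow> measure M (\<Inter>n. qball d x (inverse (real (Suc n))))"
  proof (rule Lim_measure_decseq)
    show "range (\<lambda>n. qball d x (inverse (real (Suc n)))) \<subseteq> sets M" by auto
    show "decseq (\<lambda>n. qball d x (inverse (real (Suc n))))"
      by (intro decseq_SucI qball_mono) (simp add: field_simps)
  qed (simp add: emeasure_qball)
  also have "(\<Inter>n. qball d x (inverse (real (Suc n)))) = {x}"
  proof -
    have "\<exists>n. inverse (real (Suc n)) \<le> d x y" if "y \<noteq> x" for y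
      using reals_Archimedean[of "d x y"] d_pos[of x y] that by (blast intro: less_imp_le)
    then show ?thesis by (force simp: mem_qball not_less[symmetric])
  qed
  finally have "(\<lambda>n. vol x (inverse (real (Suc n)))) \<longlonglongrightarrow> 0"
    using emeasure_point[of x] by (simp add: measure_def)
  then have "\<forall>\<^sub>F n in sequentially. vol x (inverse (real (Suc n))) < \<epsilon>"
    using assms by (rule order_tendstoD)
  then obtain n where "vol x (inverse (real (Suc n))) < \<epsilon>"
    by (auto simp: eventually_sequentially)
  then show ?thesis by (intro exI[of _ "inverse (real (Suc n))"]) simp
qed

text \<open>\<open>Vd\<close> is not symmetric, so both orders of the arguments are treated. V(x,y)
  is at most V_r(x), while V(y,x) belongs to a ball with moving centre and costs the factor of
  \<open>vol_compare\<close> with K = 1.\<close>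

lemma Vd_powr_small:
  assumes "0 < \<epsilon>" "0 < \<alpha>"
  shows "\<exists>r>0. \<forall>y. d x y < r \<longrightarrow> Vd M d x y powr \<alpha> < \<epsilon> \<and> Vd M d y x powr \<alpha> < \<epsilon>"
proof -
  \<comment> \<open>Chosen so that e times the doubling factor, raised to the power \<alpha>, is
    \<epsilon>.\<close>
  define e where "e = \<epsilon> powr (1 / \<alpha>) / (Cmu * (2 * A0) powr \<omega>)"
  have C: "0 < Cmu * (2 * A0) powr \<omega>" using Cmu_ge_1 A0_pos by simp
  have "e > 0" using assms C by (simp add: e_def)
  then obtain r where r: "r > 0" "vol x r < e" using vol_tendsto_0 by blast
  have C1: "1 \<le> Cmu * (2 * A0) powr \<omega>"
    using mult_mono[of 1 Cmu 1 "(2 * A0) powr \<omega>"] Cmu_ge_1 A0_ge_1 omega_nonneg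
    by (simp add: ge_one_powr_ge_zero)
  have small: "v powr \<alpha> < \<epsilon>" if "v \<le> Cmu * (2 * A0) powr \<omega> * vol x r" "0 \<le> v" for v
  proof -
    have "v < Cmu * (2 * A0) powr \<omega> * e"
      using that r(2) C by (smt (verit) mult_strict_left_mono)
    also have "\<dots> = \<epsilon> powr (1 / \<alpha>)"
      unfolding e_def times_divide_eq_right
      by (rule nonzero_mult_div_cancel_left) (use C in linarith)
    finally have "v powr \<alpha> < (\<epsilon> powr (1 / \<alpha>)) powr \<alpha>"
      using that assms by (intro powr_less_mono2) auto
    then show ?thesis using assms by (simp add: powr_powr)
  qed
  show ?thesis
  proof (intro exI[of _ r] conjI allI impI r(1))
    fix y assume y: "d x y < r"
    have "Vd M d x y \<le> vol x r" using y by (simp add: Vd_eq vol_mono_radius)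
    also have "\<dots> \<le> Cmu * (2 * A0) powr \<omega> * vol x r"
      using C1 mult_right_mono[OF C1, of "vol x r"] by simp
    finally show "Vd M d x y powr \<alpha> < \<epsilon>" by (intro small) (auto simp: Vd_nonneg)
    have "Vd M d y x \<le> vol y r" using y by (simp add: Vd_eq vol_mono_radius d_sym)
    also have "\<dots> \<le> Cmu * max 1 (A0 * (1 + 1) * r / r) powr \<omega> * vol x r"
      using y r by (intro vol_compare) auto
    also have "\<dots> = Cmu * (2 * A0) powr \<omega> * vol x r"
      using r A0_ge_1 by (simp add: max_def mult.commute)
    finally show "Vd M d y x powr \<alpha> < \<epsilon>" by (intro small) (auto simp: Vd_nonneg)
  qed
qed

text \<open>A positive \<alpha> is essential: for \<alpha> = 0 the bound only limits the oscillation
  of f and allows any bounded function.\<close>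

lemma lip_bound_measurable:
  fixes f :: "'a \<Rightarrow> 'b::real_normed_vector"
  assumes f: "lip_bound M d \<alpha> L f" and "0 < \<alpha>"
  shows "f \<in> borel_measurable M"
proof (rule measurable_if_locally_small)
  fix x and \<epsilon> :: real assume "0 < \<epsilon>"
  then obtain r where r: "r > 0" "\<And>y. d x y < r \<Longrightarrow> Vd M d y x powr \<alpha> < \<epsilon> / (\<bar>L\<bar> + 1)"
    using Vd_powr_small[of "\<epsilon> / (\<bar>L\<bar> + 1)" \<alpha> x] \<open>0 < \<alpha>\<close> by force
  have "dist (f y) (f x) < \<epsilon>" if "d x y < r" for y
  proof -
    have "dist (f y) (f x) \<le> L * Vd M d y x powr \<alpha>"
      using f by (simp add: lip_bound_def dist_norm)
    also have "\<dots> \<le> (\<bar>L\<bar> + 1) * Vd M d y x powr \<alpha>" by (intro mult_right_mono) auto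
    also have "\<dots> < (\<bar>L\<bar> + 1) * (\<epsilon> / (\<bar>L\<bar> + 1))" using r(2)[OF that] by (intro mult_strict_left_mono) auto
    finally show ?thesis by simp
  qed
  then show "\<exists>r>0. \<forall>y. d x y < r \<longrightarrow> dist (f y) (f x) < \<epsilon>" using r by blast
qed

end

subsection \<open>Test functions\<close>

locale smooth_homogeneous_type =
  homogeneous_type M d A0 Cmu + dyadic_points d A0 \<delta> c0 C0 A z + smoothness_index M d A0 \<delta> A z \<eta>
  for M :: "'a::topological_space measure" and d A0 Cmu \<delta> c0 C0
    and A :: "int \<Rightarrow> 'i set" and z \<eta>
begin

text \<open>The dyadic points of all generations form a countable set, and generation n comes within
  C0 \<delta>^n of every point.\<close>

lemma dense_sequence: "\<exists>zs :: nat \<Rightarrow> 'a. \<forall>x. \<forall>\<epsilon>>0. \<exists>n. d x (zs n) < \<epsilon>"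
proof -
  define D where "D = (\<Union>k. z k ` A k)"
  have "countable D" by (auto simp: D_def countable_A)
  moreover have "D \<noteq> {}" using z_dense[where k = 0] by (fastforce simp: D_def)
  ultimately have D: "range (from_nat_into D) = D" by (simp add: range_from_nat_into)
  have "\<exists>n. d x (from_nat_into D n) < \<epsilon>" if "\<epsilon> > 0" for x \<epsilon>
  proof -
    obtain n where n: "\<delta> ^ n < \<epsilon> / C0"
      using real_arch_pow_inv[of "\<epsilon> / C0" \<delta>] delta c0_C0 \<open>\<epsilon> > 0\<close> by auto
    obtain i where i: "i \<in> A (int n)" "d x (z (int n) i) \<le> C0 * \<delta> powi int n"
      using z_dense by blast
    have "C0 * \<delta> powi int n < \<epsilon>" using n c0_C0 by (simp add: field_simps)
    moreover have "z (int n) i \<in> range (from_nat_into D)" using i unfolding D by (auto simp: D_def)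
    then obtain m where "z (int n) i = from_nat_into D m" by auto
    ultimately show ?thesis using i(2) by (metis le_less_trans)
  qed
  then show ?thesis by blast
qed

text \<open>The codomain is left open because lattice operations take place among real functions and
  pairings with atoms among complex ones.\<close>

definition bump_like :: "'a \<Rightarrow> ('a \<Rightarrow> 'b::real_normed_vector) \<Rightarrow> bool" where
  "bump_like x0 g \<longleftrightarrow> (\<exists>R. \<forall>y. R \<le> d x0 y \<longrightarrow> g y = 0) \<and> (\<exists>B. \<forall>y. norm (g y) \<le> B) \<and>
     (\<exists>H. \<forall>y u. norm (g y - g u) \<le> H * d y u powr \<eta>)"

lemma test_bound_pos: "0 < test_bound M d x0 1 \<gamma> x"
  using vol_pos[of 1 x0] Vd_nonneg[of x0 x] d_nonneg[of x0 x]
  by (auto simp: test_bound_def Vr_def intro!: mult_pos_pos divide_pos_pos)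

lemma test_bound_le:
  assumes "0 \<le> \<gamma>" shows "test_bound M d x0 1 \<gamma> x \<le> 1 / vol x0 1"
proof -
  have "(1 / (1 + d x0 x)) powr \<gamma> \<le> 1"
    using assms d_nonneg[of x0 x] by (intro powr_le1) auto
  moreover have "1 / (vol x0 1 + Vd M d x0 x) \<le> 1 / vol x0 1"
    using vol_pos[of 1 x0] Vd_nonneg[of x0 x] by (intro divide_left_mono) auto
  ultimately show ?thesis unfolding test_bound_def Vr_def
    using mult_mono[of "1 / (vol x0 1 + Vd M d x0 x)" "1 / vol x0 1" "(1 / (1 + d x0 x)) powr \<gamma>" 1]
      vol_pos[of 1 x0] by simp
qed

lemma test_bound_ge:
  assumes "0 \<le> \<gamma>" "d x0 x \<le> S"
  shows "1 / (vol x0 1 + vol x0 S) * (1 / (1 + S)) powr \<gamma> \<le> test_bound M d x0 1 \<gamma> x"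
  unfolding test_bound_def Vr_def
proof (intro mult_mono divide_left_mono add_left_mono powr_mono2)
  show "Vd M d x0 x \<le> vol x0 S" using assms by (simp add: Vd_eq vol_mono_radius)
  show "0 < (vol x0 1 + vol x0 S) * (vol x0 1 + Vd M d x0 x)"
    using vol_pos[of 1 x0] Vd_nonneg[of x0 x] by (intro mult_pos_pos add_pos_nonneg) auto
  show "0 < (1 + S) * (1 + d x0 x)"
    using assms d_nonneg[of x0 x] by (intro mult_pos_pos) auto
qed (use assms d_nonneg[of x0 x] Vd_nonneg[of x0 x] in auto)

text \<open>On a ball about x0 the weight \<open>test_bound\<close> is bounded below, so a large
  constant absorbs everything. Outside it, g vanishes at x and at every y that the regularity
  condition compares with x.\<close>

lemma bump_like_test_space:
  assumes g: "bump_like x0 g" and "\<beta> \<le> \<eta>" "0 \<le> \<gamma>"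
  shows "g \<in> test_space M d A0 x0 1 \<beta> \<gamma>"
proof -
  obtain R B H where R: "\<And>y. R \<le> d x0 y \<Longrightarrow> g y = 0" and B: "\<And>y. norm (g y) \<le> B"
    and H: "\<And>y u. norm (g y - g u) \<le> H * d y u powr \<eta>"
    using g unfolding bump_like_def by blast
  have B0: "0 \<le> B" using norm_ge_zero B order_trans by blast
  \<comment> \<open>If d(x0,x) > S, no y with d(x0,y) < R satisfies d(x,y) \<le> (1 + d(x0,x)) / (2
    A0): the quasi-triangle inequality would give d(x0,x) \<le> A0 max(0,R) + (1 + d(x0,x)) / 2,
    that is d(x0,x) \<le> S.\<close>
  define S where "S = 2 * A0 * max 0 R + 1"
  have S: "R \<le> S" "1 \<le> S"
  proof -
    have "1 * max 0 R \<le> (2 * A0) * max 0 R" using A0_ge_1 by (intro mult_right_mono) auto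
    then show "R \<le> S" "1 \<le> S" by (auto simp: S_def)
  qed
  define b where "b = 1 / (vol x0 1 + vol x0 S) * (1 / (1 + S)) powr \<gamma>"
  have "0 < vol x0 1 + vol x0 S" using vol_pos[of 1 x0] by (intro add_pos_nonneg) auto
  then have b: "0 < b" using S by (auto simp: b_def)
  have bt: "b \<le> test_bound M d x0 1 \<gamma> x" if "d x0 x \<le> S" for x
    using test_bound_ge[OF assms(3) that] by (simp add: b_def)
  define C where "C = (B + max 0 H * (1 + S) powr \<eta> + 1) / b"
  have C: "0 < C" using b B0 by (auto simp: C_def intro!: divide_pos_pos add_nonneg_pos)
  have CB: "B \<le> C * b" and CH: "max 0 H * (1 + S) powr \<eta> \<le> C * b"
    using b B0 by (auto simp: C_def)
  have "C \<in> test_constants M d A0 x0 1 \<beta> \<gamma> g"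
    unfolding test_constants_def
  proof (intro CollectI conjI C allI impI)
    fix x
    show "norm (g x) \<le> C * test_bound M d x0 1 \<gamma> x"
    proof (cases "d x0 x \<le> S")
      case True
      have "norm (g x) \<le> C * b" using B CB order_trans by blast
      also have "\<dots> \<le> C * test_bound M d x0 1 \<gamma> x" using bt[OF True] C by (intro mult_left_mono) auto
      finally show ?thesis .
    next
      case False
      then have "g x = 0" using R S by simp
      then show ?thesis using C test_bound_pos[of x0 \<gamma> x] by simp
    qed
    fix y assume le: "d x y \<le> (1 + d x0 x) / (2 * A0)"
    define \<rho> where "\<rho> = 1 + d x0 x"
    have \<rho>: "1 \<le> \<rho>" using d_nonneg by (simp add: \<rho>_def)
    show "norm (g x - g y) \<le> C * (d x y / (1 + d x0 x)) powr \<beta> * test_bound M d x0 1 \<gamma> x"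
    proof (cases "d x0 x \<le> S")
      case True
      have "\<rho> / (2 * A0) \<le> \<rho> / 1" using \<rho> A0_ge_1 by (intro divide_left_mono) auto
      then have s1: "d x y / \<rho> \<le> 1" using le \<rho> by (simp add: \<rho>_def)
      have "norm (g x - g y) \<le> max 0 H * d x y powr \<eta>"
        using H[of x y] by (smt (verit) mult_right_mono powr_ge_zero)
      also have "d x y powr \<eta> = (d x y / \<rho> * \<rho>) powr \<eta>" using \<rho> by simp
      also have "\<dots> = (d x y / \<rho>) powr \<eta> * \<rho> powr \<eta>"
        using \<rho> d_nonneg by (intro powr_mult)
      also have "max 0 H * \<dots> \<le> max 0 H * ((d x y / \<rho>) powr \<beta> * (1 + S) powr \<eta>)"
        using s1 d_nonneg[of x y] \<rho> True eta assms
        by (intro mult_left_mono mult_mono powr_mono' powr_mono2) (auto simp: \<rho>_def)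
      also have "\<dots> \<le> (d x y / \<rho>) powr \<beta> * (C * b)"
        using mult_left_mono[OF CH, of "(d x y / \<rho>) powr \<beta>"] by (simp add: mult_ac)
      also have "\<dots> \<le> (d x y / \<rho>) powr \<beta> * (C * test_bound M d x0 1 \<gamma> x)"
        using bt[OF True] C by (intro mult_left_mono) auto
      finally show ?thesis by (simp add: \<rho>_def mult_ac)
    next
      case False
      have "R \<le> d x0 y"
      proof (rule ccontr)
        assume "\<not> R \<le> d x0 y"
        then have "A0 * (d x0 y + d y x) \<le> A0 * (max 0 R + (1 + d x0 x) / (2 * A0))"
          using le A0_pos by (intro mult_left_mono add_mono) (auto simp: d_sym)
        also have "\<dots> = A0 * max 0 R + (1 + d x0 x) / 2" using A0_pos by (simp add: field_simps)
        finally have "d x0 x \<le> A0 * max 0 R + (1 + d x0 x) / 2"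
          using d_quasi_triangle[of x0 x y] by linarith
        moreover have "S = 2 * (A0 * max 0 R) + 1" by (simp add: S_def)
        ultimately show False using False by argo
      qed
      then have "g x = 0" "g y = 0" using R S False by auto
      then show ?thesis using C test_bound_pos[of x0 \<gamma> x] by simp
    qed
  qed
  then show ?thesis by (auto simp: test_space_def)
qed

section \<open>Linear structure of the test spaces and of the closure \<open>G0\<close>\<close>

text \<open>Both powers have a base of at most 1, so lowering an exponent only weakens the
  condition. For the regularity quotient this uses A0 \<ge> 1.\<close>

lemma test_constants_mono:
  assumes "\<beta> \<le> \<beta>'" "\<gamma> \<le> \<gamma>'"
  shows "test_constants M d A0 x0 1 \<beta>' \<gamma>' f \<subseteq> test_constants M d A0 x0 1 \<beta> \<gamma> f"
proof
  fix C assume C: "C \<in> test_constants M d A0 x0 1 \<beta>' \<gamma>' f"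
  have t: "test_bound M d x0 1 \<gamma>' x \<le> test_bound M d x0 1 \<gamma> x" for x
    using assms d_nonneg[of x0 x] Vd_nonneg[of x0 x] vol_pos[of 1 x0]
    unfolding test_bound_def Vr_def by (intro mult_left_mono powr_mono') auto
  show "C \<in> test_constants M d A0 x0 1 \<beta> \<gamma> f"
    unfolding test_constants_def
  proof (intro CollectI conjI allI impI)
    show "0 < C" using C by (simp add: test_constants_def)
    fix x
    show "norm (f x) \<le> C * test_bound M d x0 1 \<gamma> x"
      using C mult_left_mono[OF t[of x], of C] by (force simp: test_constants_def intro: order_trans)
    fix y assume le: "d x y \<le> (1 + d x0 x) / (2 * A0)"
    have "(1 + d x0 x) / (2 * A0) \<le> (1 + d x0 x) / 1"
      using d_nonneg[of x0 x] A0_ge_1 by (intro divide_left_mono) auto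
    then have s1: "d x y / (1 + d x0 x) \<le> 1" using le d_nonneg[of x0 x] by simp
    have "norm (f x - f y) \<le> C * (d x y / (1 + d x0 x)) powr \<beta>' * test_bound M d x0 1 \<gamma>' x"
      using C le by (simp add: test_constants_def)
    also have "\<dots> \<le> C * (d x y / (1 + d x0 x)) powr \<beta> * test_bound M d x0 1 \<gamma> x"
      using C assms s1 d_nonneg[of x y] d_nonneg[of x0 x] t[of x] test_bound_pos[of x0 \<gamma>' x]
      by (intro mult_mono powr_mono') (auto simp: test_constants_def)
    finally show "norm (f x - f y) \<le> C * (d x y / (1 + d x0 x)) powr \<beta> * test_bound M d x0 1 \<gamma> x" .
  qed
qed

lemma test_constants_add:
  assumes "C1 \<in> test_constants M d A0 x0 1 \<beta> \<gamma> f" "C2 \<in> test_constants M d A0 x0 1 \<beta> \<gamma> g"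
  shows "C1 + C2 \<in> test_constants M d A0 x0 1 \<beta> \<gamma> (\<lambda>x. f x + g x)"
  unfolding test_constants_def
proof (intro CollectI conjI allI impI)
  show "0 < C1 + C2" using assms by (simp add: test_constants_def)
  fix x
  have "norm (f x) \<le> C1 * test_bound M d x0 1 \<gamma> x" "norm (g x) \<le> C2 * test_bound M d x0 1 \<gamma> x"
    using assms by (auto simp: test_constants_def)
  then show "norm (f x + g x) \<le> (C1 + C2) * test_bound M d x0 1 \<gamma> x"
    using norm_triangle_ineq[of "f x" "g x"] by (simp add: algebra_simps)
  fix y assume "d x y \<le> (1 + d x0 x) / (2 * A0)"
  then have "norm (f x - f y) \<le> C1 * (d x y / (1 + d x0 x)) powr \<beta> * test_bound M d x0 1 \<gamma> x"
    "norm (g x - g y) \<le> C2 * (d x y / (1 + d x0 x)) powr \<beta> * test_bound M d x0 1 \<gamma> x"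
    using assms by (auto simp: test_constants_def)
  then show "norm (f x + g x - (f y + g y))
      \<le> (C1 + C2) * (d x y / (1 + d x0 x)) powr \<beta> * test_bound M d x0 1 \<gamma> x"
    using norm_triangle_ineq[of "f x - f y" "g x - g y"] by (simp add: algebra_simps)
qed

lemma test_constants_cmult:
  assumes "C \<in> test_constants M d A0 x0 1 \<beta> \<gamma> f" and "norm c \<le> k" "0 < k"
  shows "k * C \<in> test_constants M d A0 x0 1 \<beta> \<gamma> (\<lambda>x. c * f x)"
  unfolding test_constants_def
proof (intro CollectI conjI allI impI)
  show "0 < k * C" using assms by (simp add: test_constants_def)
  fix x
  have "norm (f x) \<le> C * test_bound M d x0 1 \<gamma> x"
    using assms by (auto simp: test_constants_def)
  then have "norm c * norm (f x) \<le> k * (C * test_bound M d x0 1 \<gamma> x)"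
    using assms by (intro mult_mono) auto
  then show "norm (c * f x) \<le> k * C * test_bound M d x0 1 \<gamma> x"
    by (simp add: norm_mult mult.assoc)
  fix y assume "d x y \<le> (1 + d x0 x) / (2 * A0)"
  then have "norm (f x - f y) \<le> C * (d x y / (1 + d x0 x)) powr \<beta> * test_bound M d x0 1 \<gamma> x"
    using assms by (auto simp: test_constants_def)
  then have "norm c * norm (f x - f y) \<le> k * (C * (d x y / (1 + d x0 x)) powr \<beta> * test_bound M d x0 1 \<gamma> x)"
    using assms by (intro mult_mono) auto
  then show "norm (c * f x - c * f y) \<le> k * C * (d x y / (1 + d x0 x)) powr \<beta> * test_bound M d x0 1 \<gamma> x"
    by (simp add: norm_mult mult.assoc flip: right_diff_distrib)
qed

lemma test_norm_le: "C \<in> test_constants M d A0 x0 1 \<beta> \<gamma> f \<Longrightarrow> test_norm M d A0 x0 1 \<beta> \<gamma> f \<le> C"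
  unfolding test_norm_def by (rule cInf_lower) (auto simp: bdd_below_def test_constants_def intro: less_imp_le)

lemma test_norm_less:
  "f \<in> test_space M d A0 x0 1 \<beta> \<gamma> \<Longrightarrow> test_norm M d A0 x0 1 \<beta> \<gamma> f < e \<Longrightarrow>
    \<exists>C\<in>test_constants M d A0 x0 1 \<beta> \<gamma> f. C < e"
  unfolding test_norm_def test_space_def using cInf_lessD by blast

lemma test_space_add:
  "f \<in> test_space M d A0 x0 1 \<beta> \<gamma> \<Longrightarrow> g \<in> test_space M d A0 x0 1 \<beta> \<gamma> \<Longrightarrow>
    (\<lambda>x. f x + g x) \<in> test_space M d A0 x0 1 \<beta> \<gamma>"
  unfolding test_space_def using test_constants_add by blast

lemma test_space_cmult:
  "f \<in> test_space M d A0 x0 1 \<beta> \<gamma> \<Longrightarrow> (\<lambda>x. c * f x) \<in> test_space M d A0 x0 1 \<beta> \<gamma>"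
  unfolding test_space_def using test_constants_cmult[of _ x0 \<beta> \<gamma> f c "norm c + 1"]
  by (smt (verit) empty_iff equals0I mem_Collect_eq norm_ge_zero)

lemma test_space_diff:
  assumes "f \<in> test_space M d A0 x0 1 \<beta> \<gamma>" "g \<in> test_space M d A0 x0 1 \<beta> \<gamma>"
  shows "(\<lambda>x. f x - g x) \<in> test_space M d A0 x0 1 \<beta> \<gamma>"
  using test_space_add[OF assms(1) test_space_cmult[OF assms(2), of "-1"]] by simp

lemma test_space_mono:
  "\<beta> \<le> \<beta>' \<Longrightarrow> \<gamma> \<le> \<gamma>' \<Longrightarrow> test_space M d A0 x0 1 \<beta>' \<gamma>' \<subseteq> test_space M d A0 x0 1 \<beta> \<gamma>"
  unfolding test_space_def using test_constants_mono[of \<beta> \<beta>' \<gamma> \<gamma>'] by blast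

lemma G0_test_space: "f \<in> G0 M d A0 x0 \<eta> \<beta> \<gamma> \<Longrightarrow> f \<in> test_space M d A0 x0 1 \<beta> \<gamma>"
  by (simp add: G0_def)

text \<open>Explicit constants are easier to add and scale than infima. The infimum
  \<open>test_norm\<close> yields a constant below \<epsilon> only if the set of constants is
  nonempty, so f - g must first be placed in the larger space, which is where \<beta>, \<gamma>
  \<le> \<eta> enters.\<close>

lemma G0_approx:
  assumes le: "\<beta> \<le> \<eta>" "\<gamma> \<le> \<eta>" and f: "f \<in> G0 M d A0 x0 \<eta> \<beta> \<gamma>" and "0 < \<epsilon>"
  shows "\<exists>g\<in>test_space M d A0 x0 1 \<eta> \<eta>. \<exists>C\<in>test_constants M d A0 x0 1 \<beta> \<gamma> (\<lambda>x. f x - g x). C < \<epsilon>"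
proof -
  obtain g where g: "g \<in> test_space M d A0 x0 1 \<eta> \<eta>"
      "test_norm M d A0 x0 1 \<beta> \<gamma> (\<lambda>x. f x - g x) < \<epsilon>"
    using f \<open>0 < \<epsilon>\<close> unfolding G0_def by blast
  have "(\<lambda>x. f x - g x) \<in> test_space M d A0 x0 1 \<beta> \<gamma>"
    by (rule test_space_diff[OF G0_test_space[OF f] subsetD[OF test_space_mono[OF le] g(1)]])
  from test_norm_less[OF this g(2)] g(1) show ?thesis by blast
qed

lemma G0_add:
  assumes le: "\<beta> \<le> \<eta>" "\<gamma> \<le> \<eta>" and "f \<in> G0 M d A0 x0 \<eta> \<beta> \<gamma>" "g \<in> G0 M d A0 x0 \<eta> \<beta> \<gamma>"
  shows "(\<lambda>x. f x + g x) \<in> G0 M d A0 x0 \<eta> \<beta> \<gamma>"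
  unfolding G0_def
proof (intro CollectI conjI allI impI test_space_add G0_test_space assms)
  fix \<epsilon> :: real assume "0 < \<epsilon>"
  then have "0 < \<epsilon> / 2" by simp
  obtain f' C1 where f': "f' \<in> test_space M d A0 x0 1 \<eta> \<eta>"
    and C1: "C1 \<in> test_constants M d A0 x0 1 \<beta> \<gamma> (\<lambda>x. f x - f' x)" "C1 < \<epsilon> / 2"
    using G0_approx[OF assms(1-3) \<open>0 < \<epsilon> / 2\<close>] by blast
  obtain g' C2 where g': "g' \<in> test_space M d A0 x0 1 \<eta> \<eta>"
    and C2: "C2 \<in> test_constants M d A0 x0 1 \<beta> \<gamma> (\<lambda>x. g x - g' x)" "C2 < \<epsilon> / 2"
    using G0_approx[OF assms(1,2,4) \<open>0 < \<epsilon> / 2\<close>] by blast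
  have "test_norm M d A0 x0 1 \<beta> \<gamma> (\<lambda>x. f x + g x - (f' x + g' x)) \<le> C1 + C2"
    using test_norm_le[OF test_constants_add[OF C1(1) C2(1)]] by (simp add: algebra_simps)
  with C1 C2 show "\<exists>h\<in>test_space M d A0 x0 1 \<eta> \<eta>.
      test_norm M d A0 x0 1 \<beta> \<gamma> (\<lambda>x. f x + g x - h x) < \<epsilon>"
    by (intro bexI[of _ "\<lambda>x. f' x + g' x"] test_space_add f' g') auto
qed

lemma G0_cmult:
  assumes le: "\<beta> \<le> \<eta>" "\<gamma> \<le> \<eta>" and f: "f \<in> G0 M d A0 x0 \<eta> \<beta> \<gamma>"
  shows "(\<lambda>x. c * f x) \<in> G0 M d A0 x0 \<eta> \<beta> \<gamma>"
  unfolding G0_def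
proof (intro CollectI conjI allI impI test_space_cmult G0_test_space assms)
  fix \<epsilon> :: real assume "0 < \<epsilon>"
  \<comment> \<open>Test constants are strictly positive, so the factor must be positive even for c
    = 0.\<close>
  define k where "k = norm c + 1"
  have k: "0 < k" "norm c \<le> k" by (auto simp: k_def add_nonneg_pos)
  then have "0 < \<epsilon> / k" using \<open>0 < \<epsilon>\<close> by simp
  obtain f' C1 where f': "f' \<in> test_space M d A0 x0 1 \<eta> \<eta>"
    and C1: "C1 \<in> test_constants M d A0 x0 1 \<beta> \<gamma> (\<lambda>x. f x - f' x)" "C1 < \<epsilon> / k"
    using G0_approx[OF assms \<open>0 < \<epsilon> / k\<close>] by blast
  have "test_norm M d A0 x0 1 \<beta> \<gamma> (\<lambda>x. c * f x - c * f' x) \<le> k * C1"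
    using test_norm_le[OF test_constants_cmult[OF C1(1) k(2,1)]] by (simp add: algebra_simps)
  also have "\<dots> < \<epsilon>" using C1(2) k by (simp add: field_simps)
  finally show "\<exists>h\<in>test_space M d A0 x0 1 \<eta> \<eta>.
      test_norm M d A0 x0 1 \<beta> \<gamma> (\<lambda>x. c * f x - h x) < \<epsilon>"
    by (intro bexI[of _ "\<lambda>x. c * f' x"] test_space_cmult f')
qed

lemma bump_like_G0:
  assumes "bump_like x0 g" "\<beta> \<le> \<eta>" "\<gamma> \<le> \<eta>" "0 \<le> \<gamma>"
  shows "g \<in> G0 M d A0 x0 \<eta> \<beta> \<gamma>"
  unfolding G0_def
proof (intro CollectI conjI allI impI)
  fix \<epsilon> :: real assume \<epsilon>: "0 < \<epsilon>"
  \<comment> \<open>A bump is its own approximant: it lies in the (\<eta>,\<eta>) space, and every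
    positive number is a test constant of the zero function.\<close>
  have "\<epsilon> / 2 \<in> test_constants M d A0 x0 1 \<beta> \<gamma> (\<lambda>x. g x - g x)"
    using \<epsilon> less_imp_le[OF test_bound_pos[of x0 \<gamma>]] by (simp add: test_constants_def)
  from test_norm_le[OF this] \<epsilon>
  show "\<exists>h\<in>test_space M d A0 x0 1 \<eta> \<eta>. test_norm M d A0 x0 1 \<beta> \<gamma> (\<lambda>x. g x - h x) < \<epsilon>"
    using eta by (intro bexI[of _ g] bump_like_test_space assms) auto
qed (rule bump_like_test_space[OF assms(1,2,4)])

section \<open>Test functions are measurable and Lipschitz\<close>

lemma test_constants_measurable:
  assumes C: "C \<in> test_constants M d A0 x0 1 \<beta> \<gamma> f" and "0 < \<beta>" "0 \<le> \<gamma>"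
  shows "f \<in> borel_measurable M"
proof (rule measurable_if_locally_small)
  fix x and \<epsilon> :: real assume \<epsilon>: "0 < \<epsilon>"
  define \<rho> where "\<rho> = 1 + d x0 x"
  have \<rho>: "1 \<le> \<rho>" using d_nonneg by (simp add: \<rho>_def)
  define T where "T = C * test_bound M d x0 1 \<gamma> x"
  have T: "0 < T" using C test_bound_pos by (simp add: T_def test_constants_def)
  \<comment> \<open>The first entry makes the regularity condition applicable; the second solves
    (r/\<rho>)^\<beta> T = \<epsilon>.\<close>
  define r where "r = min (\<rho> / (2 * A0)) (\<rho> * (\<epsilon> / T) powr (1 / \<beta>))"
  have "0 < r" using \<rho> A0_pos \<epsilon> T by (simp add: r_def)
  moreover have "dist (f y) (f x) < \<epsilon>" if y: "d x y < r" for y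
  proof -
    have "norm (f x - f y) \<le> C * (d x y / (1 + d x0 x)) powr \<beta> * test_bound M d x0 1 \<gamma> x"
      using C y by (simp add: test_constants_def r_def \<rho>_def)
    also have "\<dots> = (d x y / \<rho>) powr \<beta> * T" by (simp add: T_def \<rho>_def)
    also have "\<dots> < ((\<epsilon> / T) powr (1 / \<beta>)) powr \<beta> * T"
      using y \<rho> d_nonneg[of x y] T \<open>0 < \<beta>\<close>
      by (intro mult_strict_right_mono powr_less_mono2) (auto simp: r_def field_simps)
    also have "\<dots> = \<epsilon>" using T \<epsilon> \<open>0 < \<beta>\<close> by (simp add: powr_powr)
    finally show ?thesis by (simp add: dist_norm norm_minus_commute)
  qed
  ultimately show "\<exists>r>0. \<forall>y. d x y < r \<longrightarrow> dist (f y) (f x) < \<epsilon>" by blast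
qed

text \<open>With s = d(x,y) and \<rho> = 1 + d(x0,x), enlarging B(x,s) by doubling until it contains
  B(x0,\<rho>), and hence B(x0,1), bounds V(x,y) below by a multiple of min(1, s/\<rho>)^\<omega>.
  Raised to \<alpha>, this dominates the regularity factor (s/\<rho>)^\<beta> since \<omega>\<alpha>
  \<le> \<beta>. K does not depend on f, so the estimate later passes to the norm.\<close>

lemma test_function_lip_bound:
  assumes "0 \<le> \<alpha>" "\<omega> * \<alpha> \<le> \<beta>" "0 \<le> \<gamma>"
  obtains K where "0 < K" and "\<And>C f. C \<in> test_constants M d A0 x0 1 \<beta> \<gamma> f \<Longrightarrow> lip_bound M d \<alpha> (K * C) f"
proof -
  define v where "v = vol x0 1"
  have v: "0 < v" by (simp add: v_def vol_pos)
  define K0 where "K0 = (Cmu * (4 * A0 * A0) powr \<omega> / v) powr \<alpha>"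
  have K0: "0 < K0" using Cmu_ge_1 A0_pos v by (simp add: K0_def)
  \<comment> \<open>The size condition bounds a difference of two values by 2 C / v, and K0 is the
    price of replacing \<open>m powr \<beta>\<close> by V(x,y)^\<alpha>.\<close>
  define K where "K = 2 * K0 / v"
  have "lip_bound M d \<alpha> (K * C) f" if C: "C \<in> test_constants M d A0 x0 1 \<beta> \<gamma> f" for C f
    unfolding lip_bound_def
  proof (intro allI)
    fix x y
    have C0: "0 < C" using C by (simp add: test_constants_def)
    show "norm (f x - f y) \<le> K * C * Vd M d x y powr \<alpha>"
    proof (cases "x = y")
      case False
      define s where "s = d x y"
      have s: "0 < s" using False by (simp add: s_def d_pos)
      define \<rho> where "\<rho> = 1 + d x0 x"
      have \<rho>: "1 \<le> \<rho>" using d_nonneg by (simp add: \<rho>_def)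
      \<comment> \<open>One quantity for both regimes: m dominates s/\<rho> where the regularity
        condition applies and equals 1 beyond, where the size condition is used at both
        points.\<close>
      define m where "m = min 1 (2 * A0 * s / \<rho>)"
      have m: "0 < m" "m \<le> 1" "m \<le> 2 * A0 * s / \<rho>" using s \<rho> A0_pos by (auto simp: m_def)
      have "max 1 (A0 * (1 + 1) * \<rho> / s) \<le> 4 * A0 * A0 / m"
      proof -
        have "1 \<le> A0 * A0" using A0_ge_1 mult_mono[of 1 A0 1 A0] by simp
        then have "1 * 1 \<le> (4 * A0 * A0) * (1 / m)" using m by (intro mult_mono) auto
        moreover have "A0 * (1 + 1) * \<rho> / s \<le> 4 * A0 * A0 / m"
        proof -
          have "m * \<rho> \<le> 2 * A0 * s" using m(3) \<rho> by (simp add: field_simps)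
          then have "(2 * A0) * (m * \<rho>) \<le> (2 * A0) * (2 * A0 * s)" using A0_pos by (intro mult_left_mono) auto
          then show ?thesis using m s by (simp add: field_simps)
        qed
        ultimately show ?thesis by simp
      qed
      then have "max 1 (A0 * (1 + 1) * \<rho> / s) powr \<omega> \<le> (4 * A0 * A0 / m) powr \<omega>"
        using omega_nonneg by (intro powr_mono2) auto
      also have "\<dots> = (4 * A0 * A0) powr \<omega> / m powr \<omega>" using m A0_pos by (simp add: powr_divide)
      finally have "Cmu * max 1 (A0 * (1 + 1) * \<rho> / s) powr \<omega> * vol x s
          \<le> Cmu * ((4 * A0 * A0) powr \<omega> / m powr \<omega>) * vol x s"
        using Cmu_ge_1 by (intro mult_right_mono mult_left_mono) auto
      moreover have "v \<le> vol x0 \<rho>" using \<rho> by (simp add: v_def vol_mono_radius)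
      moreover have "vol x0 \<rho> \<le> Cmu * max 1 (A0 * (1 + 1) * \<rho> / s) powr \<omega> * vol x s"
        using s \<rho> by (intro vol_compare) (auto simp: \<rho>_def d_sym)
      ultimately have "v \<le> Cmu * ((4 * A0 * A0) powr \<omega> / m powr \<omega>) * vol x s" by linarith
      then have "m powr \<omega> \<le> Cmu * (4 * A0 * A0) powr \<omega> / v * vol x s"
        using v m by (simp add: field_simps)
      then have "(m powr \<omega>) powr \<alpha> \<le> (Cmu * (4 * A0 * A0) powr \<omega> / v * vol x s) powr \<alpha>"
        using assms by (intro powr_mono2) auto
      also have "\<dots> = K0 * Vd M d x y powr \<alpha>"
        using Cmu_ge_1 v by (subst powr_mult) (auto simp: K0_def Vd_eq s_def)
      finally have mb: "m powr \<beta> \<le> K0 * Vd M d x y powr \<alpha>"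
        using powr_mono'[OF assms(2), of m] m by (simp add: powr_powr)
      have tv: "C * test_bound M d x0 1 \<gamma> u \<le> C / v" for u
        using mult_left_mono[OF test_bound_le[OF assms(3), of x0 u], of C] C0 by (simp add: v_def)
      have "norm (f x - f y) \<le> 2 * C / v * m powr \<beta>"
      proof (cases "s \<le> \<rho> / (2 * A0)")
        case True
        have "\<rho> / (2 * A0) \<le> \<rho> / 1" using \<rho> A0_ge_1 by (intro divide_left_mono) auto
        then have "s / \<rho> \<le> 1" using True \<rho> by simp
        moreover have "1 * s / \<rho> \<le> 2 * A0 * s / \<rho>"
          using s \<rho> A0_ge_1 by (intro divide_right_mono mult_right_mono) auto
        ultimately have ms: "s / \<rho> \<le> m" by (simp add: m_def)
        have \<beta>: "0 \<le> \<beta>" using assms omega_nonneg by (meson mult_nonneg_nonneg order_trans)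
        have "norm (f x - f y) \<le> C * (s / \<rho>) powr \<beta> * test_bound M d x0 1 \<gamma> x"
          using C True by (simp add: test_constants_def s_def \<rho>_def)
        also have "\<dots> = (s / \<rho>) powr \<beta> * (C * test_bound M d x0 1 \<gamma> x)" by simp
        also have "\<dots> \<le> m powr \<beta> * (C / v)"
          using ms s \<rho> \<beta> C0 test_bound_pos[of x0 \<gamma> x] v
          by (intro mult_mono powr_mono2 tv) auto
        also have "\<dots> \<le> 2 * C / v * m powr \<beta>" using C0 v by (simp add: field_simps)
        finally show ?thesis .
      next
        case False
        then have "m = 1" using \<rho> A0_pos by (simp add: m_def field_simps)
        moreover have "norm (f u) \<le> C / v" for u
          using C tv[of u] by (force simp: test_constants_def intro: order_trans)
        then have "norm (f x - f y) \<le> C / v + C / v"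
          using norm_triangle_ineq4[of "f x" "f y"] by (meson add_mono order_trans)
        ultimately show ?thesis by simp
      qed
      also have "\<dots> \<le> 2 * C / v * (K0 * Vd M d x y powr \<alpha>)" using mb C0 v by (intro mult_left_mono) auto
      finally show ?thesis by (simp add: K_def mult_ac)
    qed simp
  qed
  moreover have "0 < K" using K0 v by (simp add: K_def)
  ultimately show thesis using that by blast
qed

end

subsection \<open>Approximation of Lipschitz functions by bumps\<close>

lemma Max_fun_closed:
  fixes h :: "'i \<Rightarrow> 'a \<Rightarrow> 'b::linorder"
  assumes "finite S" "S \<noteq> {}" "\<And>j. j \<in> S \<Longrightarrow> P (h j)"
    and "\<And>f g. P f \<Longrightarrow> P g \<Longrightarrow> P (\<lambda>x. max (f x) (g x))"
  shows "P (\<lambda>x. MAX j\<in>S. h j x)"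
  using assms(1-3) by (induction S rule: finite_ne_induct) (simp_all add: assms(4))

lemma Min_fun_closed:
  fixes h :: "'i \<Rightarrow> 'a \<Rightarrow> 'b::linorder"
  assumes "finite S" "S \<noteq> {}" "\<And>j. j \<in> S \<Longrightarrow> P (h j)"
    and "\<And>f g. P f \<Longrightarrow> P g \<Longrightarrow> P (\<lambda>x. min (f x) (g x))"
  shows "P (\<lambda>x. MIN j\<in>S. h j x)"
  using assms(1-3) by (induction S rule: finite_ne_induct) (simp_all add: assms(4))

lemma tendsto_Min_finite:
  fixes a :: "'i \<Rightarrow> 'n \<Rightarrow> 'b::linorder_topology"
  assumes "finite S" "S \<noteq> {}" "\<And>i. i \<in> S \<Longrightarrow> (a i \<longlongrightarrow> b i) F"
  shows "((\<lambda>m. MIN i\<in>S. a i m) \<longlongrightarrow> (MIN i\<in>S. b i)) F"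
  using assms by (induction S rule: finite_ne_induct) (simp_all add: tendsto_min)

lemma Max_atMost_tendsto_SUP:
  fixes a :: "nat \<Rightarrow> real"
  assumes "bdd_above (range a)"
  shows "(\<lambda>m. MAX j\<in>{..m}. a j) \<longlonglongrightarrow> (SUP j. a j)"
proof (rule increasing_tendsto)
  show "\<forall>\<^sub>F m in sequentially. (MAX j\<in>{..m}. a j) \<le> (SUP j. a j)"
    using assms by (auto intro!: always_eventually cSUP_upper)
  fix l assume "l < (SUP j. a j)"
  then obtain j where j: "l < a j" using assms by (auto simp: less_cSUP_iff)
  have "l < (MAX j\<in>{..m}. a j)" if "j \<le> m" for m
    using j that by (subst Max_gr_iff) auto
  then show "\<forall>\<^sub>F m in sequentially. l < (MAX j\<in>{..m}. a j)"
    by (auto simp: eventually_sequentially)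
qed

lemma abs_max_diff: "\<bar>max a b - max c e\<bar> \<le> \<bar>a - c\<bar> + \<bar>b - e\<bar>" for a b c e :: real
  by (auto simp: max_def)

lemma abs_min_diff: "\<bar>min a b - min c e\<bar> \<le> \<bar>a - c\<bar> + \<bar>b - e\<bar>" for a b c e :: real
  by (auto simp: min_def)

lemma lip_bound_mono:
  "lip_bound M d \<alpha> L f \<Longrightarrow> L \<le> L' \<Longrightarrow> lip_bound M d \<alpha> L' f"
  unfolding lip_bound_def by (meson mult_right_mono order_trans powr_ge_zero)

text \<open>The constant is the same before and after, so maxima over arbitrarily large finite
  families stay uniformly Lipschitz.\<close>

lemma lip_bound_max:
  fixes f g :: "'a \<Rightarrow> real"
  shows "lip_bound M d \<alpha> L f \<Longrightarrow> lip_bound M d \<alpha> L g \<Longrightarrow> lip_bound M d \<alpha> L (\<lambda>x. max (f x) (g x))"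
  unfolding lip_bound_def real_norm_def by (smt (verit))

lemma lip_bound_min:
  fixes f g :: "'a \<Rightarrow> real"
  shows "lip_bound M d \<alpha> L f \<Longrightarrow> lip_bound M d \<alpha> L g \<Longrightarrow> lip_bound M d \<alpha> L (\<lambda>x. min (f x) (g x))"
  unfolding lip_bound_def real_norm_def by (smt (verit))

lemma lip_bound_lim:
  assumes "\<And>n. lip_bound M d \<alpha> L (g n)" "\<And>x. (\<lambda>n. g n x) \<longlonglongrightarrow> f x"
  shows "lip_bound M d \<alpha> L f"
  unfolding lip_bound_def
proof (intro allI)
  fix x y
  have "(\<lambda>n. norm (g n x - g n y)) \<longlonglongrightarrow> norm (f x - f y)"
    by (intro tendsto_intros assms)
  then show "norm (f x - f y) \<le> L * Vd M d x y powr \<alpha>"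
    using assms(1) by (intro LIMSEQ_le_const2) (auto simp: lip_bound_def)
qed

context smooth_homogeneous_type
begin

section \<open>Rescaled bumps with a uniform Lipschitz constant\<close>

text \<open>A simultaneous choice of bumps for all balls with one constant. With
  \<open>1 \<le> C\<close> the Hoelder estimate also covers the trivial bound 1 for points at least
  r apart.\<close>

definition bump_family :: "real \<Rightarrow> ('a \<Rightarrow> real \<Rightarrow> 'a \<Rightarrow> real) \<Rightarrow> bool" where
  "bump_family C \<phi> \<longleftrightarrow> 1 \<le> C \<and> (\<forall>x y. \<forall>r>0. indicator (qball d x r) y \<le> \<phi> x r y) \<and>
     (\<forall>x y. \<forall>r>0. \<phi> x r y \<le> indicator (qball d x (2 * A0 * r)) y) \<and>
     (\<forall>x y u. \<forall>r>0. \<bar>\<phi> x r y - \<phi> x r u\<bar> \<le> C * (d y u / r) powr \<eta>)"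

lemma bump_family_exists: "\<exists>C \<phi>. bump_family C \<phi>"
proof -
  obtain C where "\<forall>x. \<forall>r>0. \<exists>\<phi> :: 'a \<Rightarrow> real.
        (\<forall>y. indicator (qball d x r) y \<le> \<phi> y \<and> \<phi> y \<le> indicator (qball d x (2 * A0 * r)) y) \<and>
        (\<forall>y u. \<bar>\<phi> y - \<phi> u\<bar> \<le> C * (d y u / r) powr \<eta>)"
    using bumps by blast
  then obtain \<phi> :: "'a \<Rightarrow> real \<Rightarrow> 'a \<Rightarrow> real" where \<phi>: "\<And>x r. 0 < r \<Longrightarrow>
        (\<forall>y. indicator (qball d x r) y \<le> \<phi> x r y \<and> \<phi> x r y \<le> indicator (qball d x (2 * A0 * r)) y) \<and>
        (\<forall>y u. \<bar>\<phi> x r y - \<phi> x r u\<bar> \<le> C * (d y u / r) powr \<eta>)"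
    by metis
  have "\<bar>\<phi> x r y - \<phi> x r u\<bar> \<le> max 1 C * (d y u / r) powr \<eta>" if "0 < r" for x r y u
    using \<phi>[OF that, of x] by (smt (verit) max.cobounded2 mult_right_mono powr_ge_zero)
  with \<phi> show ?thesis
    unfolding bump_family_def by (intro exI[of _ "max 1 C"] exI[of _ \<phi>]) simp
qed

lemma bump_family_range:
  assumes "bump_family C \<phi>" "0 < r"
  shows "0 \<le> \<phi> x r y" "\<phi> x r y \<le> 1"
    and "d x y < r \<Longrightarrow> \<phi> x r y = 1" and "2 * A0 * r \<le> d x y \<Longrightarrow> \<phi> x r y = 0"
proof -
  have 1: "indicator (qball d x r) y \<le> \<phi> x r y" "\<phi> x r y \<le> indicator (qball d x (2 * A0 * r)) y"
    using assms by (auto simp: bump_family_def)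
  have 2: "0 \<le> indicat_real (qball d x r) y" "indicat_real (qball d x (2 * A0 * r)) y \<le> 1"
    by (auto simp: indicator_def)
  show r: "0 \<le> \<phi> x r y" "\<phi> x r y \<le> 1" using 1 2 by linarith+
  show "d x y < r \<Longrightarrow> \<phi> x r y = 1" using 1 r by (simp add: mem_qball)
  show "2 * A0 * r \<le> d x y \<Longrightarrow> \<phi> x r y = 0" using 1 r by (simp add: mem_qball)
qed

lemma bump_family_bump_like:
  assumes \<phi>: "bump_family C \<phi>" "0 < r"
  shows "bump_like x0 (\<phi> x r)"
  unfolding bump_like_def
proof (intro conjI exI allI impI)
  fix y assume "A0 * (d x0 x + 2 * A0 * r) \<le> d x0 y"
  also have "d x0 y \<le> A0 * (d x0 x + d x y)" by (rule d_quasi_triangle)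
  finally show "\<phi> x r y = 0"
    using A0_pos by (intro bump_family_range(4)[OF \<phi>]) auto
next
  show "norm (\<phi> x r y) \<le> 1" for y using bump_family_range[OF \<phi>, of x y] by simp
  show "norm (\<phi> x r y - \<phi> x r u) \<le> (C / r powr \<eta>) * d y u powr \<eta>" for y u
    using assms d_nonneg[of y u] by (simp add: bump_family_def powr_divide)
qed

text \<open>Let s = d(x,y) and R = max(r,s). If the bump distinguishes x from y, one of them is
  within 2 A0 r of u, so B(u,R) and B(x,s) are comparable up to the factor (R/s)^\<omega>. The bump
  differs by at most C (s/R)^\<eta>, and \<omega>\<alpha> \<le> \<eta> lets this pay for
  (R/s)^(\<omega>\<alpha>). The normalisation by V_r(u)^\<alpha> makes K independent of u and
  r.\<close>

lemma bump_family_lip_bound: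
  assumes \<phi>: "bump_family C \<phi>" and \<alpha>: "0 \<le> \<alpha>" "\<omega> * \<alpha> \<le> \<eta>"
  shows "\<exists>K>0. \<forall>u. \<forall>r>0. lip_bound M d \<alpha> K (\<lambda>x. vol u r powr \<alpha> * \<phi> u r x)"
proof (intro exI conjI allI impI)
  \<comment> \<open>This is the factor A0 (K + 1) of \<open>vol_compare\<close> with K = 3 A0^2,
    where d(x,u) \<le> A0 (A0 R + 2 A0 R) when only y is known to be near u.\<close>
  define a where "a = A0 * (3 * A0 * A0 + 1)"
  have AA: "1 \<le> A0 * A0" using mult_mono[of 1 A0 1 A0] A0_ge_1 by simp
  have a: "1 \<le> a"
    using mult_mono[of 1 A0 1 "3 * A0 * A0 + 1"] A0_ge_1 AA by (simp add: a_def)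
  show "0 < C * (Cmu * a powr \<omega>) powr \<alpha>"
    using \<phi> a Cmu_ge_1 by (auto simp: bump_family_def)
  fix u and r :: real assume r: "0 < r"
  show "lip_bound M d \<alpha> (C * (Cmu * a powr \<omega>) powr \<alpha>) (\<lambda>x. vol u r powr \<alpha> * \<phi> u r x)"
    unfolding lip_bound_def
  proof (intro allI)
    fix x y
    have C1: "1 \<le> C" using \<phi> by (simp add: bump_family_def)
    show "norm (vol u r powr \<alpha> * \<phi> u r x - vol u r powr \<alpha> * \<phi> u r y)
        \<le> C * (Cmu * a powr \<omega>) powr \<alpha> * Vd M d x y powr \<alpha>"
    proof (cases "\<phi> u r x = \<phi> u r y")
      case True
      then show ?thesis using C1 by simp
    next
      case False
      define s where "s = d x y"
      have s: "0 < s" using False by (auto simp: s_def intro!: d_pos)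
      \<comment> \<open>For s \<ge> r this gives s/R = 1, and the trivial bound on the bump
        suffices.\<close>
      define R where "R = max r s"
      have R: "0 < R" "s \<le> R" "r \<le> R" using r by (auto simp: R_def)
      have AR: "2 * A0 * r \<le> 2 * A0 * R" using R(3) A0_pos by simp
      have "d u x < 2 * A0 * r \<or> d u y < 2 * A0 * r"
        using False bump_family_range(4)[OF \<phi> r, of u] by (metis not_le)
      then have "d x u \<le> 3 * A0 * A0 * R"
      proof
        assume *: "d u x < 2 * A0 * r"
        have "d x u \<le> (2 * A0) * R"
          using * AR d_sym[of u] by simp
        also have "\<dots> \<le> (3 * A0 * A0) * R" 
          using R A0_ge_1 mult_mono[of 2 3 A0 "A0 * A0"] AA mult_right_mono[of 1 A0 A0]
          by (intro mult_right_mono) auto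
        finally show ?thesis .
      next
        assume *: "d u y < 2 * A0 * r"
        have "d x u \<le> A0 * (d x y + d y u)" by (rule d_quasi_triangle)
        also have "\<dots> \<le> A0 * (A0 * R + 2 * A0 * R)"
        proof (intro mult_left_mono add_mono)
          show "d x y \<le> A0 * R" using R mult_right_mono[of 1 A0 R] A0_ge_1 unfolding s_def by linarith
          show "d y u \<le> 2 * A0 * R"
            using * AR d_sym[of u] by simp
        qed (use A0_pos in auto)
        finally show ?thesis by (simp add: algebra_simps)
      qed
      then have "vol u R \<le> Cmu * max 1 (A0 * (3 * A0 * A0 + 1) * R / s) powr \<omega> * vol x s"
        using s R A0_pos by (intro vol_compare) auto
      also have "max 1 (A0 * (3 * A0 * A0 + 1) * R / s) = a * (R / s)"
      proof -
        have "1 * 1 \<le> a * (R / s)" using a s R by (intro mult_mono) auto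
        then show ?thesis by (simp add: a_def)
      qed
      also have "(a * (R / s)) powr \<omega> = a powr \<omega> / (s / R) powr \<omega>"
        using a s R by (simp add: powr_mult powr_divide)
      finally have "(s / R) powr \<omega> * vol u R \<le> Cmu * a powr \<omega> * vol x s"
        using s R by (simp add: field_simps)
      then have "(s / R) powr \<omega> * vol u r \<le> Cmu * a powr \<omega> * vol x s"
        using vol_mono_radius[OF R(3), of u] by (meson mult_left_mono order_trans powr_ge_zero)
      then have "((s / R) powr \<omega> * vol u r) powr \<alpha> \<le> (Cmu * a powr \<omega> * vol x s) powr \<alpha>"
        using \<alpha> by (intro powr_mono2) auto
      then have le: "(s / R) powr (\<omega> * \<alpha>) * vol u r powr \<alpha> \<le> (Cmu * a powr \<omega>) powr \<alpha> * Vd M d x y powr \<alpha>"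
        using Cmu_ge_1 a by (simp add: powr_mult powr_powr Vd_eq s_def)
      have "\<bar>\<phi> u r x - \<phi> u r y\<bar> \<le> C * (s / R) powr \<eta>"
      proof (cases "r \<le> s")
        case True
        then have "\<bar>\<phi> u r x - \<phi> u r y\<bar> \<le> 1 * 1"
          using bump_family_range(1,2)[OF \<phi> r, of u x] bump_family_range(1,2)[OF \<phi> r, of u y] by auto
        then show ?thesis using True C1 s by (simp add: R_def)
      next
        case False
        then show ?thesis using \<phi> r by (simp add: bump_family_def R_def s_def)
      qed
      also have "\<dots> \<le> C * (s / R) powr (\<omega> * \<alpha>)"
        using C1 \<alpha> s R by (intro mult_left_mono powr_mono') auto
      finally have "vol u r powr \<alpha> * \<bar>\<phi> u r x - \<phi> u r y\<bar> \<le> vol u r powr \<alpha> * (C * (s / R) powr (\<omega> * \<alpha>))"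
        by (intro mult_left_mono) auto
      also have "\<dots> \<le> C * ((Cmu * a powr \<omega>) powr \<alpha> * Vd M d x y powr \<alpha>)"
        using mult_left_mono[OF le, of C] C1 by (simp add: mult_ac)
      finally show ?thesis by (simp add: abs_mult mult.assoc flip: right_diff_distrib)
    qed
  qed
qed

section \<open>The lattice of functions that are constant outside a ball\<close>

text \<open>The building blocks of the McShane-type formula equal a constant far from their centres.
  Subtracting it leaves a test function, and the pairing with an atom does not change.\<close>

definition flat_at_infinity :: "'a \<Rightarrow> ('a \<Rightarrow> real) \<Rightarrow> bool" where
  "flat_at_infinity x0 g \<longleftrightarrow> (\<exists>c. bump_like x0 (\<lambda>x. g x - c))"

text \<open>One criterion for maxima and minima. Both domination hypotheses come from
  \<open>abs_max_diff\<close> or \<open>abs_min_diff\<close>: once with the constants at infinity as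
  second pair, once with the values at another point.\<close>

lemma bump_like_combine:
  fixes g h k :: "'a \<Rightarrow> real"
  assumes "bump_like x0 g" "bump_like x0 h"
    and le: "\<And>x. \<bar>k x\<bar> \<le> \<bar>g x\<bar> + \<bar>h x\<bar>" "\<And>x y. \<bar>k x - k y\<bar> \<le> \<bar>g x - g y\<bar> + \<bar>h x - h y\<bar>"
  shows "bump_like x0 k"
proof -
  obtain R B H where g: "\<And>y. R \<le> d x0 y \<Longrightarrow> g y = 0" "\<And>y. \<bar>g y\<bar> \<le> B"
      "\<And>y u. \<bar>g y - g u\<bar> \<le> H * d y u powr \<eta>"
    using assms(1) unfolding bump_like_def real_norm_def by blast
  obtain R' B' H' where h: "\<And>y. R' \<le> d x0 y \<Longrightarrow> h y = 0" "\<And>y. \<bar>h y\<bar> \<le> B'"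
      "\<And>y u. \<bar>h y - h u\<bar> \<le> H' * d y u powr \<eta>"
    using assms(2) unfolding bump_like_def real_norm_def by blast
  show ?thesis unfolding bump_like_def real_norm_def
  proof (intro conjI exI allI impI)
    show "k y = 0" if "max R R' \<le> d x0 y" for y
      using le(1)[of y] g(1)[of y] h(1)[of y] that by simp
    show "\<bar>k y\<bar> \<le> B + B'" for y using le(1)[of y] g(2)[of y] h(2)[of y] by linarith
    show "\<bar>k y - k u\<bar> \<le> (H + H') * d y u powr \<eta>" for y u
      using le(2)[of y u] g(3)[of y u] h(3)[of y u] by (simp add: distrib_right)
  qed
qed

lemma flat_at_infinity_max:
  assumes "flat_at_infinity x0 g" "flat_at_infinity x0 h"
  shows "flat_at_infinity x0 (\<lambda>x. max (g x) (h x))"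
proof -
  obtain c e where "bump_like x0 (\<lambda>x. g x - c)" "bump_like x0 (\<lambda>x. h x - e)"
    using assms by (auto simp: flat_at_infinity_def)
  then have "bump_like x0 (\<lambda>x. max (g x) (h x) - max c e)"
    by (rule bump_like_combine) (auto simp: abs_max_diff)
  then show ?thesis by (auto simp: flat_at_infinity_def)
qed

lemma flat_at_infinity_min:
  assumes "flat_at_infinity x0 g" "flat_at_infinity x0 h"
  shows "flat_at_infinity x0 (\<lambda>x. min (g x) (h x))"
proof -
  obtain c e where "bump_like x0 (\<lambda>x. g x - c)" "bump_like x0 (\<lambda>x. h x - e)"
    using assms by (auto simp: flat_at_infinity_def)
  then have "bump_like x0 (\<lambda>x. min (g x) (h x) - min c e)"
    by (rule bump_like_combine) (auto simp: abs_min_diff)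
  then show ?thesis by (auto simp: flat_at_infinity_def)
qed

lemma bump_like_cmult:
  fixes g :: "'a \<Rightarrow> real"
  assumes "bump_like x0 g" shows "bump_like x0 (\<lambda>x. c * g x)"
proof -
  obtain R B H where g: "\<And>y. R \<le> d x0 y \<Longrightarrow> g y = 0" "\<And>y. \<bar>g y\<bar> \<le> B"
      "\<And>y u. \<bar>g y - g u\<bar> \<le> H * d y u powr \<eta>"
    using assms(1) unfolding bump_like_def real_norm_def by blast
  show ?thesis unfolding bump_like_def real_norm_def
  proof (intro conjI exI allI impI)
    show "c * g y = 0" if "R \<le> d x0 y" for y using g(1)[OF that] by simp
    show "\<bar>c * g y\<bar> \<le> \<bar>c\<bar> * B" for y using g(2)[of y] by (simp add: abs_mult mult_left_mono)
    show "\<bar>c * g y - c * g u\<bar> \<le> (\<bar>c\<bar> * H) * d y u powr \<eta>" for y u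
      using mult_left_mono[OF g(3)[of y u], of "\<bar>c\<bar>"]
      by (simp add: abs_mult mult.assoc flip: right_diff_distrib)
  qed
qed

lemma bump_like_of_real:
  "bump_like x0 g \<Longrightarrow> bump_like x0 (\<lambda>x. of_real (g x) :: 'b::real_normed_algebra_1)"
  unfolding bump_like_def by (simp flip: of_real_diff)

lemma positive_rationals_enumeration: "\<exists>rs :: nat \<Rightarrow> real. range rs = {r \<in> \<rat>. 0 < r}"
proof -
  have "countable {r \<in> \<rat>. 0 < (r::real)}" using countable_rat by (rule countable_subset[rotated]) auto
  moreover have "{r \<in> \<rat>. 0 < (r::real)} \<noteq> {}" using zero_less_one Rats_1 by blast
  ultimately show ?thesis by (intro exI[of _ "from_nat_into {r \<in> \<rat>. 0 < (r::real)}"] range_from_nat_into)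
qed

text \<open>A McShane-type formula: \<open>f = inf\<^sub>u sup\<^sub>r (f u + K (V\<^sub>r(u))\<^sup>\<alpha> (1 - \<phi>\<^sub>u\<^sub>,\<^sub>r))\<close>, where \<open>u\<close> runs through a
  dense sequence and \<open>r\<close> through the positive rationals. The inner supremum lies between
  \<open>f u + L V(u,x)\<^sup>\<alpha>\<close> and \<open>f u + K V(u,x)\<^sup>\<alpha>\<close>.\<close>

lemma lip_bound_induct:
  fixes f :: "'a \<Rightarrow> real"
  assumes \<alpha>: "0 < \<alpha>" "\<omega> * \<alpha> \<le> \<eta>" and f: "lip_bound M d \<alpha> L f"
    and flat: "\<And>g K. flat_at_infinity x0 g \<Longrightarrow> lip_bound M d \<alpha> K g \<Longrightarrow> P g"
    and lim: "\<And>g h K. (\<And>n. lip_bound M d \<alpha> K (g n)) \<Longrightarrow> (\<And>n. P (g n)) \<Longrightarrow>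
      (\<And>x. (\<lambda>n. g n x) \<longlonglongrightarrow> h x) \<Longrightarrow> P h"
  shows "P f"
proof -
  obtain C \<phi> where \<phi>: "bump_family C \<phi>" using bump_family_exists by blast
  obtain zs :: "nat \<Rightarrow> 'a" where zs: "\<And>x \<epsilon>. 0 < \<epsilon> \<Longrightarrow> \<exists>n. d x (zs n) < \<epsilon>"
    using dense_sequence by blast
  obtain rs :: "nat \<Rightarrow> real" where rs: "range rs = {r \<in> \<rat>. 0 < r}"
    using positive_rationals_enumeration by blast
  have rs_pos: "0 < rs j" for j using rs by blast
  define L' where "L' = max 1 L"
  have f: "lip_bound M d \<alpha> L' f" and L': "0 < L'"
    using lip_bound_mono[OF f] by (auto simp: L'_def)
  \<comment> \<open>The lower estimate replaces V(u,x) by V_r(u) with r as small as d(u,x) / (4 A0).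
    Doubling then costs Cmu (4 A0)^\<omega>, here raised to \<alpha>.\<close>
  define K where "K = L' * (Cmu * (4 * A0) powr \<omega>) powr \<alpha>"
  have K: "0 < K" using L' Cmu_ge_1 A0_pos by (simp add: K_def)
  define h where "h i j x = f (zs i) + K * (vol (zs i) (rs j) powr \<alpha> * (1 - \<phi> (zs i) (rs j) x))" for i j x
  note range = bump_family_range[OF \<phi> rs_pos]
  obtain Kb where Kb: "0 < Kb" "\<And>u r. 0 < r \<Longrightarrow> lip_bound M d \<alpha> Kb (\<lambda>x. vol u r powr \<alpha> * \<phi> u r x)"
    using bump_family_lip_bound[OF \<phi> less_imp_le[OF \<alpha>(1)] \<alpha>(2)] by blast
  have h_lip: "lip_bound M d \<alpha> (K * Kb) (h i j)" for i j
    unfolding lip_bound_def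
  proof (intro allI)
    fix x y
    have "norm (h i j x - h i j y) = K * norm (vol (zs i) (rs j) powr \<alpha> * \<phi> (zs i) (rs j) x
        - vol (zs i) (rs j) powr \<alpha> * \<phi> (zs i) (rs j) y)"
      using K by (simp add: h_def abs_mult abs_minus_commute flip: right_diff_distrib)
    also have "\<dots> \<le> K * (Kb * Vd M d x y powr \<alpha>)"
      using Kb(2)[OF rs_pos[of j], of "zs i"] K unfolding lip_bound_def by (intro mult_left_mono) auto
    finally show "norm (h i j x - h i j y) \<le> K * Kb * Vd M d x y powr \<alpha>" by (simp add: mult.assoc)
  qed
  have h_flat: "flat_at_infinity x0 (h i j)" for i j
  proof -
    define c where "c = f (zs i) + K * vol (zs i) (rs j) powr \<alpha>"
    have "bump_like x0 (\<lambda>x. (- K * vol (zs i) (rs j) powr \<alpha>) * \<phi> (zs i) (rs j) x)"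
      by (intro bump_like_cmult bump_family_bump_like[OF \<phi> rs_pos])
    then have "bump_like x0 (\<lambda>x. h i j x - c)" by (simp add: h_def c_def algebra_simps)
    then show ?thesis by (auto simp: flat_at_infinity_def)
  qed
  have h_upper: "h i j x \<le> f (zs i) + K * Vd M d (zs i) x powr \<alpha>" for i j x
  proof -
    have "vol (zs i) (rs j) powr \<alpha> * (1 - \<phi> (zs i) (rs j) x) \<le> Vd M d (zs i) x powr \<alpha>"
    proof (cases "d (zs i) x < rs j")
      case True
      then show ?thesis using range(3) by simp
    next
      case False
      have "vol (zs i) (rs j) powr \<alpha> * (1 - \<phi> (zs i) (rs j) x) \<le> vol (zs i) (rs j) powr \<alpha> * 1"
        using range(1) by (intro mult_left_mono) auto
      also have "\<dots> \<le> Vd M d (zs i) x powr \<alpha>"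
        using False \<alpha> by (auto simp: Vd_eq intro!: powr_mono2 vol_mono_radius)
      finally show ?thesis .
    qed
    then show ?thesis using K by (simp add: h_def)
  qed
  have h_lower: "\<exists>j. f x \<le> h i j x" for i x
  proof (cases "zs i = x")
    case True
    then show ?thesis using range(3)[of "zs i" x] rs_pos by (auto simp: h_def)
  next
    case False
    define t where "t = d (zs i) x"
    have t: "0 < t" using False by (simp add: t_def d_pos)
    \<comment> \<open>A radius below t / (2 A0) keeps x outside the support of the bump, so the full
      term K V_r(u)^\<alpha> counts; a radius above t / (4 A0) keeps V_r(u) comparable to
      V(u,x).\<close>
    have "t / (4 * A0) < t / (2 * A0)" using t A0_pos by (simp add: field_simps)
    then obtain r where r: "r \<in> \<rat>" "t / (4 * A0) < r" "r < t / (2 * A0)" using Rats_dense_in_real by blast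
    have "0 < t / (4 * A0)" using t A0_pos by simp
    then have r0: "0 < r" using r by linarith
    then obtain j where j: "rs j = r" using r rs by (metis (mono_tags, lifting) mem_Collect_eq rangeE)
    have "2 * A0 * r \<le> d (zs i) x" using r A0_pos by (simp add: t_def field_simps)
    then have "\<phi> (zs i) (rs j) x = 0" using range(4) j by blast
    then have hj: "h i j x = f (zs i) + K * vol (zs i) r powr \<alpha>" by (simp add: h_def j)
    have "vol (zs i) t \<le> vol (zs i) ((4 * A0) * r)"
      using r A0_pos by (intro vol_mono_radius) (simp add: field_simps)
    also have "\<dots> \<le> Cmu * (4 * A0) powr \<omega> * vol (zs i) r"
      using r0 A0_ge_1 by (intro vol_scale) auto
    finally have "vol (zs i) t powr \<alpha> \<le> (Cmu * (4 * A0) powr \<omega> * vol (zs i) r) powr \<alpha>"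
      using \<alpha> by (intro powr_mono2) auto
    also have "\<dots> = (Cmu * (4 * A0) powr \<omega>) powr \<alpha> * vol (zs i) r powr \<alpha>"
      by (rule powr_mult)
    finally have "L' * Vd M d (zs i) x powr \<alpha> \<le> K * vol (zs i) r powr \<alpha>"
      using L' by (simp add: K_def Vd_eq t_def mult.assoc)
    moreover have "f x - f (zs i) \<le> L' * Vd M d (zs i) x powr \<alpha>"
      using f by (simp add: lip_bound_def abs_le_iff)
    ultimately show ?thesis using hj by (intro exI[of _ j]) simp
  qed
  define F where "F i x = (SUP j. h i j x)" for i x
  have bdd: "bdd_above (range (\<lambda>j. h i j x))" for i x
    using h_upper by (auto simp: bdd_above_def)
  have F_upper: "F i x \<le> f (zs i) + K * Vd M d (zs i) x powr \<alpha>" for i x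
    unfolding F_def using h_upper by (intro cSUP_least) auto
  have F_lower: "f x \<le> F i x" for i x
    using h_lower[of x i] cSUP_upper[OF _ bdd[of i x]] unfolding F_def by (meson UNIV_I order_trans)
  define Fm where "Fm i m x = (MAX j\<in>{..m}. h i j x)" for i m x
  define G where "G n x = (MIN i\<in>{..n}. F i x)" for n x
  \<comment> \<open>Truncating the supremum and the infimum gives a finite lattice expression. The
    closure of P under limits is used twice: first as m grows with n fixed, then as n grows.\<close>
  define Gm where "Gm n m x = (MIN i\<in>{..n}. Fm i m x)" for n m x
  have Gm_lim: "(\<lambda>m. Gm n m x) \<longlonglongrightarrow> G n x" for n x
    unfolding Gm_def G_def Fm_def F_def
    by (intro tendsto_Min_finite Max_atMost_tendsto_SUP bdd) auto
  have Fm: "flat_at_infinity x0 (Fm i m) \<and> lip_bound M d \<alpha> (K * Kb) (Fm i m)" for i m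
    unfolding Fm_def[abs_def]
    by (rule Max_fun_closed) (auto simp: h_flat h_lip flat_at_infinity_max lip_bound_max)
  have Gm: "flat_at_infinity x0 (Gm n m) \<and> lip_bound M d \<alpha> (K * Kb) (Gm n m)" for n m
    unfolding Gm_def[abs_def]
    by (rule Min_fun_closed) (use Fm in \<open>auto simp: flat_at_infinity_min lip_bound_min\<close>)
  have G_lip: "lip_bound M d \<alpha> (K * Kb) (G n)" for n
    by (rule lip_bound_lim[OF _ Gm_lim]) (use Gm in blast)
  have PG: "P (G n)" for n
    using Gm flat by (intro lim[of "K * Kb" "Gm n", OF _ _ Gm_lim]) blast+
  have G_lim: "(\<lambda>n. G n x) \<longlonglongrightarrow> f x" for x
  proof (rule decreasing_tendsto)
    show "\<forall>\<^sub>F n in sequentially. f x \<le> G n x"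
      using F_lower by (auto simp: G_def)
    fix l assume l: "f x < l"
    \<comment> \<open>Every F i lies above f, and F i x exceeds f x by at most (L' + K)
      V(u,x)^\<alpha> with u = \<open>zs i\<close>. The ball is centred at the moving point u, so
      the second estimate of \<open>Vd_powr_small\<close> is the relevant one.\<close>
    have "0 < (l - f x) / (L' + K)" using l L' K by simp
    then obtain r where r: "0 < r" "\<And>y. d x y < r \<Longrightarrow> Vd M d y x powr \<alpha> < (l - f x) / (L' + K)"
      using Vd_powr_small[OF _ \<alpha>(1)] by metis
    obtain i where i: "d x (zs i) < r" using zs r by blast
    have "F i x \<le> f x + (f (zs i) - f x) + K * Vd M d (zs i) x powr \<alpha>"
      using F_upper[of i x] by simp
    also have "f (zs i) - f x \<le> L' * Vd M d (zs i) x powr \<alpha>"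
      using f by (simp add: lip_bound_def abs_le_iff)
    finally have "F i x \<le> f x + (L' + K) * Vd M d (zs i) x powr \<alpha>" by (simp add: algebra_simps)
    also have "\<dots> < l" using r(2)[OF i] L' K by (simp add: field_simps)
    finally have Fl: "F i x < l" .
    have "G n x < l" if "i \<le> n" for n
      using Fl that by (auto simp: G_def Min_less_iff)
    then show "\<forall>\<^sub>F n in sequentially. G n x < l" by (auto simp: eventually_sequentially)
  qed
  show "P f" by (rule lim[OF G_lip PG G_lim])
qed

end

subsection \<open>Integrable functions orthogonal to all bumps\<close>

context homogeneous_type
begin

lemma space_M_UNIV [simp]: "x \<in> space M"
  by (simp add: space_M)

lemma qball_exhausts: "\<exists>n::nat. x \<in> qball d x0 (real n)"
  using reals_Archimedean2[of "d x0 x"] by (simp add: mem_qball)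

lemma sigma_finite: "sigma_finite_measure M"
proof
  show "\<exists>A. countable A \<and> A \<subseteq> sets M \<and> \<Union>A = space M \<and> (\<forall>a\<in>A. emeasure M a \<noteq> \<infinity>)"
    using qball_exhausts
    by (intro exI[of _ "range (\<lambda>n. qball d undefined (real n))"])
      (auto simp: space_M emeasure_qball)
qed

text \<open>Borel regularity encloses S in a Borel set of equal measure, but the difference is known
  to be null only if that measure is finite. Hence S is cut down to balls, and dominated convergence
  removes the cut.\<close>

lemma set_integral_zero_if_Borel_zero:
  fixes f :: "'a \<Rightarrow> complex"
  assumes f: "integrable M f" and Borel: "\<And>B. B \<in> sets borel \<Longrightarrow> (LINT x:B|M. f x) = 0"
    and S: "S \<in> sets M"
  shows "(LINT x:S|M. f x) = 0"
proof -
  fix x0 :: 'a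
  have [measurable]: "f \<in> borel_measurable M" using f by auto
  define T where "T n = S \<inter> qball d x0 (real n)" for n
  have T [measurable]: "T n \<in> sets M" for n using S by (simp add: T_def)
  have T0: "(LINT x:T n|M. f x) = 0" for n
  proof -
    obtain E where E: "E \<in> sets borel" "T n \<subseteq> E" "outer_measure_of M (T n) = emeasure M E"
      using borel_regular by blast
    have [measurable]: "E \<in> sets M" using E borel_sets_M by blast
    have TE: "emeasure M E = emeasure M (T n)"
      using E(3) by (simp add: outer_measure_of_eq)
    have "emeasure M (T n) \<le> emeasure M (qball d x0 (real n))"
      by (rule emeasure_mono) (auto simp: T_def)
    then have fin: "emeasure M (T n) \<noteq> \<infinity>" by (auto simp: emeasure_qball top_unique)
    have "emeasure M (E - T n) = emeasure M E - emeasure M (T n)"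
      using fin E(2) by (intro emeasure_Diff) auto
    then have "E - T n \<in> null_sets M" using fin by (auto simp: TE null_sets_def)
    then have "AE x in M. x \<notin> E - T n" by (rule AE_not_in)
    then have "(LINT x:T n|M. f x) = (LINT x:E|M. f x)"
      unfolding set_lebesgue_integral_def
      by (intro integral_cong_AE) (use E(2) in \<open>auto simp: indicator_def elim!: eventually_mono\<close>)
    with Borel[OF E(1)] show ?thesis by simp
  qed
  have "(\<lambda>n. LINT x|M. indicator (T n) x *\<^sub>R f x) \<longlonglongrightarrow> (LINT x|M. indicator S x *\<^sub>R f x)"
  proof (rule integral_dominated_convergence[where w = "\<lambda>x. norm (f x)"])
    show "AE x in M. (\<lambda>n. indicator (T n) x *\<^sub>R f x) \<longlonglongrightarrow> indicator S x *\<^sub>R f x"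
    proof (rule AE_I2)
      fix x
      obtain m :: nat where m: "d x0 x < real m" using reals_Archimedean2 by blast
      have "\<forall>\<^sub>F n in sequentially. indicator (T n) x *\<^sub>R f x = indicator S x *\<^sub>R f x"
        using eventually_ge_at_top[of m]
        by eventually_elim (use m in \<open>auto simp: T_def mem_qball indicator_def\<close>)
      then show "(\<lambda>n. indicator (T n) x *\<^sub>R f x) \<longlonglongrightarrow> indicator S x *\<^sub>R f x"
        by (rule tendsto_eventually)
    qed
    show "AE x in M. norm (indicator (T n) x *\<^sub>R f x) \<le> norm (f x)" for n
      by (auto simp: indicator_def)
  qed (use f S in auto)
  then have "(\<lambda>n. 0) \<longlonglongrightarrow> (LINT x:S|M. f x)"
    using T0 by (simp add: set_lebesgue_integral_def)
  then show ?thesis by (simp add: LIMSEQ_const_iff)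
qed

text \<open>Dynkin's argument: open sets are stable under intersection and generate the Borel sets.
  Complements are handled by the hypothesis for the whole space.\<close>

lemma AE_zero_if_open_zero:
  fixes f :: "'a \<Rightarrow> complex"
  assumes f: "integrable M f" and op: "\<And>U. open U \<Longrightarrow> (LINT x:U|M. f x) = 0"
  shows "AE x in M. f x = 0"
proof -
  interpret sigma_finite_measure M by (rule sigma_finite)
  have fS: "set_integrable M B f" if "B \<in> sets borel" for B
    unfolding set_integrable_def using that borel_sets_M f
    by (intro integrable_mult_indicator) auto
  have Borel: "(LINT x:B|M. f x) = 0" if "B \<in> sets borel" for B
  proof -
    have "Int_stable {S :: 'a set. open S}" "{S :: 'a set. open S} \<subseteq> Pow UNIV"
      "B \<in> sigma_sets UNIV {S. open S}"
      using that by (auto simp: Int_stable_def borel_def)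
    then show ?thesis
    proof (induction rule: sigma_sets_induct_disjoint)
      case (compl A)
      have A: "A \<in> sets borel" using compl by (simp add: borel_def)
      have "(LINT x:A \<union> (UNIV - A)|M. f x) = (LINT x:A|M. f x) + (LINT x:UNIV - A|M. f x)"
        using A by (intro set_integral_Un fS) auto
      with compl op[of UNIV] show ?case by simp
    next
      case (union B)
      have B: "B i \<in> sets borel" for i using union by (auto simp: borel_def)
      then have "B i \<in> sets M" for i using borel_sets_M by blast
      then have "(LINT x:(\<Union>i. B i)|M. f x) = (\<Sum>i. (LINT x:B i|M. f x))"
        using union B by (intro lebesgue_integral_countable_add fS) (auto simp: disjoint_family_on_def)
      with union show ?case by simp
    qed (use op in \<open>auto simp: set_lebesgue_integral_def\<close>)
  qed
  show ?thesis
    by (rule density_zero[OF f]) (rule set_integral_zero_if_Borel_zero[OF f Borel])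
qed

end

context smooth_homogeneous_type
begin

lemma bump_like_max:
  assumes "bump_like x0 (g :: 'a \<Rightarrow> real)" "bump_like x0 h"
  shows "bump_like x0 (\<lambda>x. max (g x) (h x))"
  using assms by (rule bump_like_combine) (auto simp: abs_max_diff)

lemma bump_like_measurable:
  fixes g :: "'a \<Rightarrow> complex"
  assumes "bump_like x0 g"
  shows "g \<in> borel_measurable M"
  using bump_like_test_space[OF assms order.refl, of 0] test_constants_measurable eta
  unfolding test_space_def by blast

text \<open>Centres from a dense sequence and rational radii leave countably many bumps, so their
  maxima form a sequence to which dominated convergence with majorant |f| applies.\<close>

lemma AE_zero_if_bump_like_zero:
  fixes f :: "'a \<Rightarrow> complex"
  assumes f: "integrable M f" and 0: "\<And>g. bump_like x0 g \<Longrightarrow> (LINT x|M. f x * g x) = 0"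
  shows "AE x in M. f x = 0"
proof (rule AE_zero_if_open_zero[OF f])
  fix U :: "'a set" assume U: "open U"
  obtain C \<phi> where \<phi>: "bump_family C \<phi>" using bump_family_exists by blast
  obtain zs :: "nat \<Rightarrow> 'a" where zs: "\<And>x \<epsilon>. 0 < \<epsilon> \<Longrightarrow> \<exists>n. d x (zs n) < \<epsilon>"
    using dense_sequence by blast
  obtain rs :: "nat \<Rightarrow> real" where rs: "range rs = {r \<in> \<rat>. 0 < r}"
    using positive_rationals_enumeration by blast
  have rs_pos: "0 < rs j" for j using rs by blast
  note range = bump_family_range[OF \<phi> rs_pos]
  define u where "u n = zs (fst (prod_decode n))" for n
  define r where "r n = rs (snd (prod_decode n))" for n
  \<comment> \<open>Bumps whose supporting ball leaves U are replaced by zero, so that one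
    enumeration of all pairs of centre and radius serves every U.\<close>
  define e where "e n x = (if qball d (u n) (2 * A0 * r n) \<subseteq> U then \<phi> (u n) (r n) x else 0)" for n x
  define g where "g m x = (MAX n\<in>{..m}. e n x)" for m x
  have r_pos: "0 < r n" for n by (simp add: r_def rs_pos)
  have "bump_like x0 (e n)" for n
  proof (cases "qball d (u n) (2 * A0 * r n) \<subseteq> U")
    case True
    then have "e n = \<phi> (u n) (r n)" by (simp add: e_def fun_eq_iff)
    then show ?thesis using bump_family_bump_like[OF \<phi> r_pos] by simp
  next
    case False
    then have eq: "e n = (\<lambda>x. 0 * \<phi> (u n) (r n) x)" by (simp add: e_def fun_eq_iff)
    show ?thesis unfolding eq by (intro bump_like_cmult bump_family_bump_like[OF \<phi> r_pos])
  qed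
  then have g: "bump_like x0 (g m)" for m
    unfolding g_def[abs_def] by (intro Max_fun_closed[where P = "bump_like x0"] bump_like_max) auto
  have e01: "0 \<le> e n x \<and> e n x \<le> indicator U x" for n x
  proof (cases "qball d (u n) (2 * A0 * r n) \<subseteq> U \<and> d (u n) x < 2 * A0 * r n")
    case True
    then have "x \<in> U" by (auto simp: mem_qball)
    then show ?thesis
      using bump_family_range(1,2)[OF \<phi> r_pos, of "u n" n x] by (auto simp: e_def)
  next
    case False
    then have "e n x = 0"
      using bump_family_range(4)[OF \<phi> r_pos, of n "u n" x] by (auto simp: e_def)
    then show ?thesis by simp
  qed
  have g0: "0 \<le> g m x" for m x
    unfolding g_def using e01[of 0 x] by (intro Max_ge_iff[THEN iffD2]) auto
  have g1: "g m x \<le> indicator U x" for m x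
    unfolding g_def using e01 by (intro Max.boundedI) auto
  have g_lim: "(\<lambda>m. g m x) \<longlonglongrightarrow> indicator U x" for x
  proof (cases "x \<in> U")
    case False
    then have "g m x = 0" for m using g0[of m x] g1[of m x] by simp
    then show ?thesis using False by simp
  next
    case True
    then obtain t where t: "0 < t" "qball d x t \<subseteq> U" using U qball_basis by blast
    \<comment> \<open>For s below this bound, a centre within s of x has its ball of radius 2 A0 s
      inside B(x,t), hence inside U.\<close>
    have "0 < t / (A0 * (1 + 2 * A0))" using t A0_pos by (auto intro!: divide_pos_pos mult_pos_pos)
    then obtain s where s: "s \<in> \<rat>" "0 < s" "s < t / (A0 * (1 + 2 * A0))"
      using Rats_dense_in_real by blast
    then obtain j where j: "rs j = s" using rs by (metis (mono_tags, lifting) mem_Collect_eq rangeE)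
    obtain i where i: "d x (zs i) < s" using zs s by blast
    define k where "k = prod_encode (i, j)"
    have uk: "u k = zs i" "r k = s" using j by (auto simp: k_def u_def r_def)
    have "0 < A0 * (1 + 2 * A0)" using A0_pos by (auto intro!: mult_pos_pos)
    then have st: "A0 * (s + 2 * A0 * s) < t"
      using s by (simp add: field_simps)
    have "qball d (u k) (2 * A0 * r k) \<subseteq> U"
    proof
      fix y assume "y \<in> qball d (u k) (2 * A0 * r k)"
      then have "A0 * (d x (zs i) + d (zs i) y) \<le> A0 * (s + 2 * A0 * s)"
        using i uk A0_pos by (intro mult_left_mono) (auto simp: mem_qball)
      then have "d x y < t" using st d_quasi_triangle[of x y "zs i"] by linarith
      then show "y \<in> U" using t by (auto simp: mem_qball)
    qed
    then have ek: "e k x = 1" using range(3)[of "zs i" x j] i uk j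
      by (simp add: e_def d_sym)
    have "g m x = 1" if "k \<le> m" for m
    proof (rule antisym)
      show "g m x \<le> 1" using g1[of m x] True by simp
      show "1 \<le> g m x" unfolding g_def using ek that by (subst Max_ge_iff) (auto intro!: exI[of _ k] bexI[of _ k])
    qed
    then have "\<forall>\<^sub>F m in sequentially. g m x = indicator U x"
      using True by (auto simp: eventually_sequentially)
    then show ?thesis by (rule tendsto_eventually)
  qed
  have gc: "bump_like x0 (\<lambda>x. complex_of_real (g m x))" for m
    by (rule bump_like_of_real[OF g])
  have "(\<lambda>m. LINT x|M. f x * complex_of_real (g m x)) \<longlonglongrightarrow> (LINT x|M. indicator U x *\<^sub>R f x)"
  proof (rule integral_dominated_convergence[where w = "\<lambda>x. norm (f x)"])
    show "AE x in M. (\<lambda>m. f x * complex_of_real (g m x)) \<longlonglongrightarrow> indicator U x *\<^sub>R f x"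
      using tendsto_mult[OF tendsto_const tendsto_of_real[OF g_lim]]
      by (intro AE_I2) (simp add: scaleR_conv_of_real mult.commute)
    show "AE x in M. norm (f x * complex_of_real (g m x)) \<le> norm (f x)" for m
    proof (rule AE_I2)
      fix x
      have "\<bar>g m x\<bar> \<le> 1" using g0[of m x] g1[of m x] by (cases "x \<in> U") auto
      then show "norm (f x * complex_of_real (g m x)) \<le> norm (f x)"
        by (simp add: norm_mult mult_left_le)
    qed
    show "(\<lambda>x. f x * complex_of_real (g m x)) \<in> borel_measurable M" for m
      using f bump_like_measurable[OF gc] by (intro borel_measurable_times) auto
    show "(\<lambda>x. indicator U x *\<^sub>R f x) \<in> borel_measurable M"
      using f open_imp_sets[OF U] by (intro borel_measurable_scaleR borel_measurable_indicator) auto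
  qed (use f in auto)
  then show "(LINT x:U|M. f x) = 0"
    by (simp add: 0[OF gc] set_lebesgue_integral_def LIMSEQ_const_iff)
qed

end

subsection \<open>Atoms and atomic series\<close>

text \<open>The terms eventually lie below 1, where a \<le> a^p because p \<le> 1.\<close>

lemma summable_of_powr_summable:
  fixes a :: "nat \<Rightarrow> real"
  assumes "0 < p" "p \<le> 1" "\<And>j. 0 \<le> a j" "summable (\<lambda>j. a j powr p)"
  shows "summable a"
proof (rule summable_comparison_test_ev[OF _ assms(4)])
  have "(\<lambda>j. a j powr p) \<longlonglongrightarrow> 0" using assms(4) by (rule summable_LIMSEQ_zero)
  then have "\<forall>\<^sub>F j in sequentially. a j powr p < 1" by (rule order_tendstoD) simp
  then show "\<forall>\<^sub>F j in sequentially. norm (a j) \<le> a j powr p"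
  proof eventually_elim
    case (elim j)
    have "a j \<le> 1"
    proof (rule ccontr)
      assume "\<not> a j \<le> 1"
      then have "1 \<le> a j powr p" using assms by (intro ge_one_powr_ge_zero) auto
      with elim show False by simp
    qed
    then have "a j powr 1 \<le> a j powr p" using assms by (intro powr_mono') auto
    then show ?case using assms(3)[of j] by simp
  qed
qed

text \<open>A pointwise substitute for Hoelder's inequality: weighted Young with a free height t,
  with equality at y = t.\<close>

lemma mult_power_bound_Young:
  fixes y t Q :: real
  assumes "1 \<le> Q" "0 < t" "0 \<le> y"
  shows "y \<le> t powr (1 - Q) / Q * y powr Q + (1 - 1 / Q) * t"
proof (cases "y = 0")
  case True
  then show ?thesis using assms by simp
next
  case False
  have "y = (t powr (1 - Q) * y powr Q) powr (1 / Q) * t powr (1 - 1 / Q)"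
    using assms False by (simp add: powr_mult powr_powr diff_divide_distrib flip: powr_add)
  also have "\<dots> \<le> 1 / Q * (t powr (1 - Q) * y powr Q) + (1 - 1 / Q) * t"
    using assms False by (intro Youngs_inequality_0) auto
  finally show ?thesis by (simp add: mult_ac)
qed

lemma atomic_data_summable:
  assumes "atomic_data M d p q l a" "0 < p" "p \<le> 1"
  shows "summable (\<lambda>j. norm (l j))"
  by (rule summable_of_powr_summable[OF assms(2,3) norm_ge_zero])
    (rule conjunct2[OF assms(1)[unfolded atomic_data_def]])

context homogeneous_type
begin

text \<open>Let V be the volume of the ball and t = V^(-1/p), the height allowed to an atom with q =
  \<infinity>. In that case |a| \<le> t almost everywhere on the ball. For finite q, integrating
  Young's inequality at height t over the ball gives two terms, at most 1/Q and 1 - 1/Q times V^(1 -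
  1/p).\<close>

lemma hardy_atom_L1:
  assumes a: "hardy_atom M d p q a" and p: "0 < p" and q: "1 \<le> q"
  obtains x r where "0 < r" "\<And>y. r \<le> d x y \<Longrightarrow> a y = 0" "integrable M a"
    "(LINT y|M. norm (a y)) \<le> vol x r powr (1 - 1 / p)" "(LINT y|M. a y) = 0"
proof -
  obtain x r where r: "0 < r" and supp: "{y. a y \<noteq> 0} \<subseteq> qball d x r" and Lq: "a \<in> Lq_space M q"
    and norm: "Lq_norm M q a \<le> vol x r powr (enn2real (inverse q) - 1 / p)"
    and int0: "(LINT y|M. a y) = 0"
    using a unfolding hardy_atom_def by blast
  have am [measurable]: "a \<in> borel_measurable M" using Lq by (simp add: Lq_space_def)
  define V where "V = vol x r"
  have V: "0 < V" using r by (simp add: V_def vol_pos)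
  have out: "a y = 0" if "r \<le> d x y" for y using supp that by (force simp: mem_qball)
  have indV: "integrable M (\<lambda>y. c * indicat_real (qball d x r) y)" for c
    by (intro integrable_mult_right integrable_real_indicator) (auto simp: emeasure_qball)
  have intV: "(LINT y|M. c * indicat_real (qball d x r) y) = c * V" for c
    by (simp add: V_def space_M)
  define t where "t = V powr (- 1 / p)"
  have t: "0 < t" using V by (simp add: t_def)
  have tV: "t * V = V powr (1 - 1 / p)"
    using V by (simp add: t_def powr_diff powr_minus divide_inverse)
  show thesis
  proof (cases "q = \<infinity>")
    case True
    define s where "s = enn2real (esssup M (\<lambda>y. ennreal (norm (a y))))"
    have s: "s \<le> t" using norm True by (simp add: Lq_norm_def s_def t_def V_def)
    have "ennreal s = esssup M (\<lambda>y. ennreal (norm (a y)))"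
      using Lq True by (simp add: Lq_space_def s_def)
    then have "AE y in M. ennreal (norm (a y)) \<le> ennreal s"
      using esssup_AE[of "\<lambda>y. ennreal (norm (a y))" M] by simp
    then have le: "AE y in M. norm (a y) \<le> t * indicat_real (qball d x r) y"
    proof eventually_elim
      case (elim y)
      have "norm (a y) \<le> s" using elim by (simp add: s_def)
      then show ?case using s out[of y] by (auto simp: indicator_def mem_qball)
    qed
    have ia: "integrable M a"
      by (rule Bochner_Integration.integrable_bound[OF indV[of t] am]) (use le in auto)
    have "(LINT y|M. norm (a y)) \<le> (LINT y|M. t * indicat_real (qball d x r) y)"
      using ia le by (intro integral_mono_AE indV) auto
    then have L1: "(LINT y|M. norm (a y)) \<le> vol x r powr (1 - 1 / p)"
      unfolding intV tV unfolding V_def .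
    show thesis by (rule that[of r x]) (fact r out ia L1 int0)+
  next
    case False
    define Q where "Q = enn2real q"
    have qQ: "q = ennreal Q" using False by (simp add: Q_def ennreal_enn2real_if)
    have Q: "1 \<le> Q" using q qQ by (metis Q_def enn2real_nonneg ennreal_1 ennreal_le_iff)
    have invq: "enn2real (inverse q) = 1 / Q"
      using Q by (simp add: qQ inverse_ennreal divide_inverse)
    define I where "I = (LINT y|M. norm (a y) powr Q)"
    have iQ: "integrable M (\<lambda>y. norm (a y) powr Q)"
      using Lq False by (simp add: Lq_space_def Q_def)
    have I0: "0 \<le> I" by (simp add: I_def)
    have "I powr (1 / Q) \<le> V powr (1 / Q - 1 / p)"
      using norm False by (simp add: Lq_norm_def I_def V_def invq flip: Q_def)
    then have "(I powr (1 / Q)) powr Q \<le> (V powr (1 / Q - 1 / p)) powr Q"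
      using Q by (intro powr_mono2) auto
    then have I: "I \<le> V powr (1 - Q / p)"
      using Q I0 by (simp add: powr_powr left_diff_distrib)
    have tI: "t powr (1 - Q) * I \<le> V powr (1 - 1 / p)"
    proof -
      have "t powr (1 - Q) * I \<le> t powr (1 - Q) * V powr (1 - Q / p)"
        using I by (intro mult_left_mono) auto
      also have "\<dots> = V powr ((- 1 / p) * (1 - Q) + (1 - Q / p))"
        by (simp only: t_def powr_powr powr_add)
      also have "(- 1 / p) * (1 - Q) + (1 - Q / p) = 1 - 1 / p"
        using p by (simp add: field_simps)
      finally show ?thesis .
    qed
    define w where "w y = t powr (1 - Q) / Q * norm (a y) powr Q + (1 - 1 / Q) * t * indicat_real (qball d x r) y" for y
    have le: "norm (a y) \<le> w y" for y
    proof (cases "d x y < r")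
      case True
      then show ?thesis using mult_power_bound_Young[OF Q t, of "norm (a y)"]
        by (simp add: w_def mem_qball)
    next
      case False
      then show ?thesis using out by (simp add: w_def mem_qball)
    qed
    have iw: "integrable M w" unfolding w_def[abs_def] by (intro Bochner_Integration.integrable_add integrable_mult_right iQ indV)
    have ia: "integrable M a"
      by (rule Bochner_Integration.integrable_bound[OF iw am]) (intro AE_I2 order_trans[OF le], simp)
    have "(LINT y|M. norm (a y)) \<le> (LINT y|M. w y)"
      by (intro Bochner_Integration.integral_mono integrable_norm ia iw le)
    also have "\<dots> = t powr (1 - Q) / Q * I + (1 - 1 / Q) * t * V"
      unfolding w_def Bochner_Integration.integral_add[OF integrable_mult_right[OF iQ] indV] intV
      by (simp add: I_def)
    also have "\<dots> = 1 / Q * (t powr (1 - Q) * I) + (1 - 1 / Q) * (t * V)" by simp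
    also have "\<dots> \<le> 1 / Q * V powr (1 - 1 / p) + (1 - 1 / Q) * V powr (1 - 1 / p)"
      using tI tV Q by (intro add_mono mult_left_mono) auto
    also have "\<dots> = V powr (1 - 1 / p)" by (simp add: left_diff_distrib)
    finally have L1: "(LINT y|M. norm (a y)) \<le> vol x r powr (1 - 1 / p)" unfolding V_def .
    show thesis by (rule that[of r x]) (fact r out ia L1 int0)+
  qed
qed

lemma lip_bound_nonneg:
  assumes "lip_bound M d \<alpha> L f" shows "0 \<le> L"
proof -
  obtain x y where "0 < d x y" using diam_infinite by blast
  then have "0 < Vd M d x y powr \<alpha>" using Vd_pos[of x y] by (cases "x = y") auto
  moreover have "0 \<le> L * Vd M d x y powr \<alpha>"
    using assms norm_ge_zero order_trans unfolding lip_bound_def by blast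
  ultimately show ?thesis by (simp add: zero_le_mult_iff)
qed

lemma lip_bound_on_qball:
  assumes f: "lip_bound M d \<alpha> L f" and "0 \<le> \<alpha>" "d x y < r"
  shows "norm (f y - f x) \<le> L * vol x r powr \<alpha>"
proof -
  have "norm (f y - f x) = norm (f x - f y)" by (rule norm_minus_commute)
  also have "\<dots> \<le> L * Vd M d x y powr \<alpha>" using f by (simp add: lip_bound_def)
  also have "\<dots> \<le> L * vol x r powr \<alpha>"
    using assms lip_bound_nonneg[OF f]
    by (intro mult_left_mono powr_mono2) (auto simp: Vd_eq intro: vol_mono_radius)
  finally show ?thesis .
qed

lemma atom_times_lip:
  fixes f :: "'a \<Rightarrow> complex"
  assumes a: "hardy_atom M d p q a" and p: "0 < p" "p \<le> 1" and q: "1 \<le> q"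
    and f: "lip_bound M d (1 / p - 1) L f" and [measurable]: "f \<in> borel_measurable M"
  shows "integrable M (\<lambda>x. a x * f x)" and "norm (LINT x|M. a x * f x) \<le> L"
proof -
  obtain u r where r: "0 < r" and out: "\<And>y. r \<le> d u y \<Longrightarrow> a y = 0" and ia: "integrable M a"
    and a1: "(LINT y|M. norm (a y)) \<le> vol u r powr (1 - 1 / p)" and a0: "(LINT y|M. a y) = 0"
    using hardy_atom_L1[OF a p(1) q] by metis
  note [measurable] = borel_measurable_integrable[OF ia]
  have \<alpha>: "0 \<le> 1 / p - 1" using p by simp
  define W where "W = L * vol u r powr (1 / p - 1)"
  have W: "0 \<le> W" using lip_bound_nonneg[OF f] by (simp add: W_def)
  have le: "norm (a y * (f y - f u)) \<le> W * norm (a y)" for y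
  proof (cases "d u y < r")
    case True
    then show ?thesis using lip_bound_on_qball[OF f \<alpha> True]
      by (simp add: norm_mult W_def mult.commute[of _ "norm (a y)"] mult_left_mono)
  qed (simp add: out)
  have iW: "integrable M (\<lambda>y. W * norm (a y))" using ia by (intro integrable_mult_right integrable_norm)
  have i: "integrable M (\<lambda>y. a y * (f y - f u))"
    by (rule Bochner_Integration.integrable_bound[OF iW]) (use le W in auto)
  have ic: "integrable M (\<lambda>y. a y * f u)" using ia by (rule integrable_mult_left)
  have eq: "(\<lambda>y. a y * f y) = (\<lambda>y. a y * (f y - f u) + a y * f u)" by (simp add: algebra_simps)
  show "integrable M (\<lambda>x. a x * f x)" unfolding eq by (intro Bochner_Integration.integrable_add i ic)
  have "(LINT x|M. a x * f x) = (LINT y|M. a y * (f y - f u))"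
    unfolding eq by (subst Bochner_Integration.integral_add[OF i ic]) (simp add: a0)
  also have "norm \<dots> \<le> (LINT y|M. W * norm (a y))"
    using le by (intro order_trans[OF integral_norm_bound] Bochner_Integration.integral_mono integrable_norm i iW)
  also have "\<dots> \<le> W * vol u r powr (1 - 1 / p)" using a1 W by (simp add: mult_left_mono)
  also have "\<dots> = L" using vol_pos[OF r, of u] by (simp add: W_def flip: powr_add)
  finally show "norm (LINT x|M. a x * f x) \<le> L" .
qed

section \<open>Atomic series under pointwise limits\<close>

text \<open>The values at the centre of the atom's ball converge and are therefore bounded. The
  common Lipschitz constant spreads this bound over the ball, so a multiple of |a| is a
  majorant.\<close>

lemma atom_times_lip_tendsto:
  fixes f :: "nat \<Rightarrow> 'a \<Rightarrow> complex"
  assumes a: "hardy_atom M d p q a" and p: "0 < p" "p \<le> 1" and q: "1 \<le> q"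
    and f: "\<And>n. lip_bound M d (1 / p - 1) L (f n)"
    and [measurable]: "\<And>n. f n \<in> borel_measurable M" "h \<in> borel_measurable M"
    and lim: "\<And>x. (\<lambda>n. f n x) \<longlonglongrightarrow> h x"
  shows "(\<lambda>n. LINT x|M. a x * f n x) \<longlonglongrightarrow> (LINT x|M. a x * h x)"
proof -
  obtain u r where r: "0 < r" and out: "\<And>y. r \<le> d u y \<Longrightarrow> a y = 0" and ia: "integrable M a"
    using hardy_atom_L1[OF a p(1) q] by metis
  note [measurable] = borel_measurable_integrable[OF ia]
  have \<alpha>: "0 \<le> 1 / p - 1" using p by simp
  obtain B where B: "\<And>n. norm (f n u) \<le> B"
    using convergent_imp_Bseq[OF convergentI[OF lim[of u]]] by (auto simp: Bseq_def)
  define W where "W = B + L * vol u r powr (1 / p - 1)"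
  have le: "norm (a y * f n y) \<le> W * norm (a y)" for n y
  proof (cases "d u y < r")
    case True
    have "norm (f n y) \<le> norm (f n u) + norm (f n y - f n u)" by (rule norm_triangle_sub)
    also have "\<dots> \<le> W" using B[of n] lip_bound_on_qball[OF f \<alpha> True] by (simp add: W_def add_mono)
    finally show ?thesis by (simp add: norm_mult mult.commute[of W] mult_left_mono)
  qed (simp add: out)
  show ?thesis
    by (rule integral_dominated_convergence[where w = "\<lambda>y. W * norm (a y)"])
      (use ia le in \<open>auto intro!: tendsto_mult lim\<close>)
qed

text \<open>Tannery's theorem exchanges limit and sum: the j-th term is at most |l j| L for every
  n.\<close>

lemma atomic_series_tendsto:
  fixes f :: "nat \<Rightarrow> 'a \<Rightarrow> complex"
  assumes la: "atomic_data M d p q l a" and p: "0 < p" "p \<le> 1" and q: "1 \<le> q"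
    and f: "\<And>n. lip_bound M d (1 / p - 1) L (f n)"
    and m: "\<And>n. f n \<in> borel_measurable M" "h \<in> borel_measurable M"
    and lim: "\<And>x. (\<lambda>n. f n x) \<longlonglongrightarrow> h x"
  shows "(\<lambda>n. \<Sum>j. l j * (LINT x|M. a j x * f n x)) \<longlonglongrightarrow> (\<Sum>j. l j * (LINT x|M. a j x * h x))"
proof -
  have at: "hardy_atom M d p q (a j)" for j using la by (simp add: atomic_data_def)
  have sl: "summable (\<lambda>j. norm (l j))"
    by (rule atomic_data_summable[OF la p])
  have "norm (l j * (LINT x|M. a j x * f n x)) \<le> norm (l j) * L" for j n
    using atom_times_lip(2)[OF at p q f m(1)] by (simp add: norm_mult mult_left_mono)
  then have bound: "eventually (\<lambda>(j, n). norm (l j * (LINT x|M. a j x * f n x)) \<le> norm (l j) * L)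
      (at_top \<times>\<^sub>F sequentially)"
    by (intro always_eventually) auto
  show ?thesis
    using tannerys_theorem[OF tendsto_mult_left[OF atom_times_lip_tendsto[OF at p q f m lim]] bound
        summable_mult2[OF sl] sequentially_bot] by (rule conjunct2[OF conjunct2])
qed

text \<open>The bound on partial sums is there because weak-* convergence also asks the partial sums
  to be bounded functionals.\<close>

lemma atomic_series_summable:
  fixes f :: "'a \<Rightarrow> complex"
  assumes la: "atomic_data M d p q l a" and p: "0 < p" "p \<le> 1" and q: "1 \<le> q"
    and f: "lip_bound M d (1 / p - 1) L f" and m: "f \<in> borel_measurable M"
  shows "summable (\<lambda>j. l j * (LINT x|M. a j x * f x))"
    and "norm (\<Sum>j. l j * (LINT x|M. a j x * f x)) \<le> (\<Sum>j. norm (l j)) * L"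
    and "\<And>n. norm (\<Sum>j<n. l j * (LINT x|M. a j x * f x)) \<le> (\<Sum>j. norm (l j)) * L"
proof -
  have at: "hardy_atom M d p q (a j)" for j using la by (simp add: atomic_data_def)
  have sl: "summable (\<lambda>j. norm (l j))"
    by (rule atomic_data_summable[OF la p])
  have le: "norm (l j * (LINT x|M. a j x * f x)) \<le> norm (l j) * L" for j
    using atom_times_lip(2)[OF at p q f m] by (simp add: norm_mult mult_left_mono)
  have sn: "summable (\<lambda>j. norm (l j * (LINT x|M. a j x * f x)))"
    by (rule summable_comparison_test'[OF summable_mult2[OF sl, of L], of 0]) (use le in simp)
  then show "summable (\<lambda>j. l j * (LINT x|M. a j x * f x))" by (rule summable_norm_cancel)
  have total: "(\<Sum>j. norm (l j * (LINT x|M. a j x * f x))) \<le> (\<Sum>j. norm (l j)) * L"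
    using suminf_le[OF le sn summable_mult2[OF sl]] by (simp add: suminf_mult2[OF sl])
  then show "norm (\<Sum>j. l j * (LINT x|M. a j x * f x)) \<le> (\<Sum>j. norm (l j)) * L"
    using summable_norm[OF sn] by linarith
  show "norm (\<Sum>j<n. l j * (LINT x|M. a j x * f x)) \<le> (\<Sum>j. norm (l j)) * L" for n
  proof -
    have "norm (\<Sum>j<n. l j * (LINT x|M. a j x * f x)) \<le> (\<Sum>j<n. norm (l j * (LINT x|M. a j x * f x)))"
      by (rule norm_sum)
    also have "\<dots> \<le> (\<Sum>j. norm (l j * (LINT x|M. a j x * f x)))"
      using sn by (intro sum_le_suminf) auto
    finally show ?thesis using total by linarith
  qed
qed

lemma integral_atomic_sum:
  fixes f :: "'a \<Rightarrow> complex"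
  assumes "\<And>j. integrable M (\<lambda>x. a j x * f x)"
  shows "(LINT x|M. atomic_sum l a n x * f x) = (\<Sum>j<n. l j * (LINT x|M. a j x * f x))"
proof -
  have "(LINT x|M. atomic_sum l a n x * f x) = (LINT x|M. (\<Sum>j<n. l j * (a j x * f x)))"
    by (simp add: atomic_sum_def sum_distrib_right mult.assoc)
  also have "\<dots> = (\<Sum>j<n. LINT x|M. l j * (a j x * f x))"
    using assms by (intro Bochner_Integration.integral_sum integrable_mult_right)
  finally show ?thesis by simp
qed

end

text \<open>\<open>cont_dual\<close> lies inside \<open>extensional S\<close>, so the extensionality
  conditions of the product topology hold automatically.\<close>

lemma limitin_weak_star:
  "limitin (weak_star_topology S N) F T sequentially \<longleftrightarrow>
     T \<in> cont_dual S N \<and> (\<forall>\<^sub>F n in sequentially. F n \<in> cont_dual S N) \<and>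
     (\<forall>f\<in>S. (\<lambda>n. F n f) \<longlonglongrightarrow> T f)"
proof -
  have "cont_dual S N \<subseteq> extensional S" by (auto simp: cont_dual_def)
  then show ?thesis
    unfolding weak_star_topology_def limitin_subtopology limitin_componentwise
    by (auto simp: PiE_UNIV_domain PiE_def elim: eventually_mono)
qed

text \<open>The sum of the norms has a finite integral. It is therefore finite almost everywhere,
  makes the series converge pointwise, and majorises every tail.\<close>

lemma L1_series_converges:
  fixes h :: "nat \<Rightarrow> 'a \<Rightarrow> complex"
  assumes h: "\<And>j. integrable M (h j)" and s: "summable (\<lambda>j. LINT x|M. norm (h j x))"
  shows "\<exists>f. integrable M f \<and> (\<lambda>n. LINT x|M. norm (f x - (\<Sum>j<n. h j x))) \<longlonglongrightarrow> 0"
proof -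
  note [measurable] = borel_measurable_integrable[OF h]
  have hn: "integrable M (\<lambda>x. norm (h j x))" for j using h by (rule integrable_norm)
  have "(\<integral>\<^sup>+x. (\<Sum>j. ennreal (norm (h j x))) \<partial>M) = (\<Sum>j. \<integral>\<^sup>+x. ennreal (norm (h j x)) \<partial>M)"
    by (intro nn_integral_suminf) auto
  also have "\<dots> = (\<Sum>j. ennreal (LINT x|M. norm (h j x)))"
    using hn by (simp add: nn_integral_eq_integral)
  also have "\<dots> = ennreal (\<Sum>j. LINT x|M. norm (h j x))"
    using s by (intro suminf_ennreal2) auto
  finally have "(\<integral>\<^sup>+x. (\<Sum>j. ennreal (norm (h j x))) \<partial>M) \<noteq> \<infinity>" by simp
  then have "AE x in M. (\<Sum>j. ennreal (norm (h j x))) \<noteq> \<infinity>"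
    by (intro nn_integral_noteq_infinite) auto
  then have AEs: "AE x in M. summable (\<lambda>j. norm (h j x))"
    by eventually_elim (intro summable_suminf_not_top, auto)
  define f where "f x = (\<Sum>j. h j x)" for x
  have f: "integrable M f" unfolding f_def[abs_def] by (rule integrable_suminf[OF h AEs s])
  note [measurable] = borel_measurable_integrable[OF f]
  have "(\<lambda>n. LINT x|M. norm (f x - (\<Sum>j<n. h j x))) \<longlonglongrightarrow> (LINT x|M. 0)"
  proof (rule integral_dominated_convergence[where w = "\<lambda>x. \<Sum>j. norm (h j x)"])
    show "integrable M (\<lambda>x. \<Sum>j. norm (h j x))"
      using AEs s by (intro integrable_suminf hn) auto
    show "AE x in M. (\<lambda>n. norm (f x - (\<Sum>j<n. h j x))) \<longlonglongrightarrow> 0"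
      using AEs
    proof eventually_elim
      case (elim x)
      have "(\<lambda>n. \<Sum>j<n. h j x) \<longlonglongrightarrow> f x"
        unfolding f_def by (rule summable_LIMSEQ[OF summable_norm_cancel[OF elim]])
      from tendsto_norm[OF tendsto_diff[OF tendsto_const[of "f x"] this]] show ?case by simp
    qed
    show "AE x in M. norm (norm (f x - (\<Sum>j<n. h j x))) \<le> (\<Sum>j. norm (h j x))" for n
      using AEs
    proof eventually_elim
      case (elim x)
      have sn: "summable (\<lambda>j. norm (h (j + n) x))" using elim by (simp add: summable_iff_shift[of "\<lambda>j. norm (h j x)"])
      have "f x - (\<Sum>j<n. h j x) = (\<Sum>j. h (j + n) x)"
        unfolding f_def using suminf_minus_initial_segment[OF summable_norm_cancel[OF elim], of n] by simp
      also have "norm \<dots> \<le> (\<Sum>j. norm (h (j + n) x))" by (rule summable_norm[OF sn])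
      also have "\<dots> \<le> (\<Sum>j. norm (h j x))"
        using suminf_minus_initial_segment[OF elim, of n] by (simp add: sum_nonneg)
      finally show ?case by simp
    qed
  qed auto
  with f show ?thesis by auto
qed

text \<open>Not restricted to any function space, so that functionals on the Lipschitz space and on
  the test space are restrictions of one and the same map.\<close>

definition atomic_series ::
    "'a measure \<Rightarrow> (nat \<Rightarrow> complex) \<Rightarrow> (nat \<Rightarrow> 'a \<Rightarrow> complex) \<Rightarrow> ('a \<Rightarrow> complex) \<Rightarrow> complex" where
  "atomic_series M l a f = (\<Sum>j. l j * (LINT x|M. a j x * f x))"

lemma lip_bound_add:
  assumes "lip_bound M d \<alpha> L f" "lip_bound M d \<alpha> L' g"
  shows "lip_bound M d \<alpha> (L + L') (\<lambda>x. f x + g x)"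
  unfolding lip_bound_def
proof (intro allI)
  fix x y
  have "norm (f x + g x - (f y + g y)) \<le> norm (f x - f y) + norm (g x - g y)"
    using norm_triangle_ineq[of "f x - f y" "g x - g y"] by (simp add: algebra_simps)
  also have "\<dots> \<le> L * Vd M d x y powr \<alpha> + L' * Vd M d x y powr \<alpha>"
    using assms by (intro add_mono) (auto simp: lip_bound_def)
  finally show "norm (f x + g x - (f y + g y)) \<le> (L + L') * Vd M d x y powr \<alpha>"
    by (simp add: distrib_right)
qed

lemma lip_bound_cmult:
  fixes f :: "'a \<Rightarrow> complex"
  assumes "lip_bound M d \<alpha> L f"
  shows "lip_bound M d \<alpha> (norm c * L) (\<lambda>x. c * f x)"
  unfolding lip_bound_def
proof (intro allI)
  fix x y
  have "norm c * norm (f x - f y) \<le> norm c * (L * Vd M d x y powr \<alpha>)"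
    using assms by (intro mult_left_mono) (auto simp: lip_bound_def)
  then show "norm (c * f x - c * f y) \<le> norm c * L * Vd M d x y powr \<alpha>"
    by (simp add: norm_mult mult.assoc flip: right_diff_distrib)
qed

lemma lip_bound_of_real:
  "lip_bound M d \<alpha> L f \<Longrightarrow> lip_bound M d \<alpha> L (\<lambda>x. of_real (f x) :: complex)"
  unfolding lip_bound_def by (simp flip: of_real_diff)

lemma lip_bound_Re: "lip_bound M d \<alpha> L f \<Longrightarrow> lip_bound M d \<alpha> L (\<lambda>x. Re (f x))"
  unfolding lip_bound_def using abs_Re_le_cmod order_trans by (fastforce simp flip: minus_complex.sel)

lemma lip_bound_Im: "lip_bound M d \<alpha> L f \<Longrightarrow> lip_bound M d \<alpha> L (\<lambda>x. Im (f x))"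
  unfolding lip_bound_def using abs_Im_le_cmod order_trans by (fastforce simp flip: minus_complex.sel)

context homogeneous_type
begin

lemma Lip_space_lip_bound:
  assumes "f \<in> Lip_space M d \<alpha>"
  shows "f \<in> borel_measurable M" "lip_bound M d \<alpha> (Lip_norm M d \<alpha> f) f"
proof -
  show "f \<in> borel_measurable M" using assms by (simp add: Lip_space_def)
  show "lip_bound M d \<alpha> (Lip_norm M d \<alpha> f) f"
    unfolding lip_bound_def
  proof (intro allI)
    fix x y
    show "norm (f x - f y) \<le> Lip_norm M d \<alpha> f * Vd M d x y powr \<alpha>"
    proof (cases "x = y")
      case False
      have "norm (f x - f y) / Vd M d x y powr \<alpha> \<le> Lip_norm M d \<alpha> f"
        unfolding Lip_norm_def using assms False
        by (intro cSup_upper) (auto simp: Lip_space_def Lip_quotients_def)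
      moreover have "0 < Vd M d x y powr \<alpha>" using Vd_pos[OF False] by simp
      ultimately show ?thesis by (simp add: pos_divide_le_eq)
    qed simp
  qed
qed

lemma lip_bound_Lip_space:
  assumes "f \<in> borel_measurable M" "lip_bound M d \<alpha> L f"
  shows "f \<in> Lip_space M d \<alpha>"
proof -
  have "norm (f x - f y) / Vd M d x y powr \<alpha> \<le> L" if "x \<noteq> y" for x y
  proof -
    have "0 < Vd M d x y powr \<alpha>" using Vd_pos[OF that] by simp
    then show ?thesis using assms(2) by (simp add: pos_divide_le_eq lip_bound_def)
  qed
  then have "bdd_above (Lip_quotients M d \<alpha> f)"
    by (auto simp: Lip_quotients_def intro!: bdd_aboveI[of _ L])
  then show ?thesis using assms by (simp add: Lip_space_def)
qed

lemma Lip_space_add: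
  "f \<in> Lip_space M d \<alpha> \<Longrightarrow> g \<in> Lip_space M d \<alpha> \<Longrightarrow> (\<lambda>x. f x + g x) \<in> Lip_space M d \<alpha>"
  by (rule lip_bound_Lip_space[OF borel_measurable_add lip_bound_add]) (rule Lip_space_lip_bound; assumption)+

lemma Lip_space_cmult:
  "f \<in> Lip_space M d \<alpha> \<Longrightarrow> (\<lambda>x. c * f x) \<in> Lip_space M d \<alpha>"
  by (rule lip_bound_Lip_space[OF borel_measurable_times[OF borel_measurable_const] lip_bound_cmult])
    (rule Lip_space_lip_bound; assumption)+

end

subsection \<open>Coifman-Weiss and atomic Hardy spaces\<close>

locale hardy_parameters =
  smooth_homogeneous_type M d A0 Cmu \<delta> c0 C0 A z \<eta>
  for M :: "'a::topological_space measure" and d A0 Cmu \<delta> c0 C0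
    and A :: "int \<Rightarrow> 'i set" and z \<eta> +
  fixes p \<beta> \<gamma> :: real and x0 :: 'a and q :: ennreal
  assumes p_lower: "\<omega> / (\<omega> + \<eta>) < p" and p_le_1: "p \<le> 1" and q_ge_1: "1 \<le> q"
    and beta: "\<omega> * (1 / p - 1) < \<beta>" "\<beta> < \<eta>"
    and gamma: "\<omega> * (1 / p - 1) < \<gamma>" "\<gamma> < \<eta>"
begin

abbreviation \<alpha> :: real where "\<alpha> \<equiv> 1 / p - 1"
abbreviation G :: "('a \<Rightarrow> complex) set" where "G \<equiv> G0 M d A0 x0 \<eta> \<beta> \<gamma>"
abbreviation NG :: "('a \<Rightarrow> complex) \<Rightarrow> real" where "NG \<equiv> test_norm M d A0 x0 1 \<beta> \<gamma>"
abbreviation Lip :: "('a \<Rightarrow> complex) set" where "Lip \<equiv> Lip_space M d \<alpha>"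
abbreviation NLip :: "('a \<Rightarrow> complex) \<Rightarrow> real" where "NLip \<equiv> Lip_norm M d \<alpha>"

lemma p_pos: "0 < p"
proof -
  have "0 \<le> \<omega> / (\<omega> + \<eta>)" using omega_nonneg eta by simp
  then show ?thesis using p_lower by linarith
qed

lemma alpha_nonneg: "0 \<le> \<alpha>"
  using p_pos p_le_1 by simp

lemma omega_alpha_nonneg: "0 \<le> \<omega> * \<alpha>"
  by (intro mult_nonneg_nonneg omega_nonneg alpha_nonneg)

lemma beta_gamma_pos: "0 < \<beta>" "0 < \<gamma>"
  using beta gamma omega_alpha_nonneg by linarith+

lemma G_constants_nonempty: "g \<in> G \<Longrightarrow> test_constants M d A0 x0 1 \<beta> \<gamma> g \<noteq> {}"
  by (simp add: G0_def test_space_def)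

lemma G_measurable: "g \<in> G \<Longrightarrow> g \<in> borel_measurable M"
  using G_constants_nonempty test_constants_measurable beta_gamma_pos by (meson less_imp_le ex_in_conv)

text \<open>Transfers an estimate from every admissible constant to their infimum.\<close>

lemma le_mult_test_norm:
  assumes "g \<in> G" "0 \<le> b" "\<And>C. C \<in> test_constants M d A0 x0 1 \<beta> \<gamma> g \<Longrightarrow> u \<le> C * b"
  shows "u \<le> NG g * b"
proof (cases "b = 0")
  case True
  then show ?thesis using assms(3) G_constants_nonempty[OF assms(1)] by auto
next
  case False
  then have "u / b \<le> NG g"
    unfolding test_norm_def using assms
    by (intro cInf_greatest G_constants_nonempty) (auto simp: pos_divide_le_eq)
  then show ?thesis using False assms(2) by (simp add: pos_divide_le_eq)
qed

lemma G_lip_bound: "\<exists>K>0. \<forall>g\<in>G. lip_bound M d \<alpha> (K * NG g) g"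
proof -
  obtain K where K: "0 < K"
    and lip: "\<And>C f. C \<in> test_constants M d A0 x0 1 \<beta> \<gamma> f \<Longrightarrow> lip_bound M d \<alpha> (K * C) f"
    using test_function_lip_bound[OF alpha_nonneg less_imp_le[OF beta(1)] less_imp_le[OF beta_gamma_pos(2)]]
    by metis
  have "lip_bound M d \<alpha> (K * NG g) g" if g: "g \<in> G" for g
    unfolding lip_bound_def
  proof (intro allI)
    fix x y
    have "norm (g x - g y) \<le> NG g * (K * Vd M d x y powr \<alpha>)"
      using K lip by (intro le_mult_test_norm[OF g]) (auto simp: lip_bound_def mult_ac)
    then show "norm (g x - g y) \<le> K * NG g * Vd M d x y powr \<alpha>" by (simp add: mult_ac)
  qed
  with K show ?thesis by blast
qed

lemma G_bounded:
  assumes g: "g \<in> G" shows "norm (g x) \<le> NG g * (1 / vol x0 1)"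
proof (rule le_mult_test_norm[OF g])
  fix C assume C: "C \<in> test_constants M d A0 x0 1 \<beta> \<gamma> g"
  then have "norm (g x) \<le> C * test_bound M d x0 1 \<gamma> x" by (simp add: test_constants_def)
  also have "\<dots> \<le> C * (1 / vol x0 1)"
    using C beta_gamma_pos by (intro mult_left_mono test_bound_le) (auto simp: test_constants_def)
  finally show "norm (g x) \<le> C * (1 / vol x0 1)" .
qed simp

lemma G_subset_Lip: "G \<subseteq> Lip"
  using G_lip_bound G_measurable lip_bound_Lip_space by blast

lemma bump_like_in_G: "bump_like x0 g \<Longrightarrow> g \<in> G"
  using beta gamma beta_gamma_pos by (intro bump_like_G0) auto

section \<open>Atomic series as functionals on the Lipschitz and test spaces\<close>

text \<open>What the Lipschitz space and the test space have in common, so that weak-* convergence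
  is treated once for both.\<close>

definition lip_dominated :: "('a \<Rightarrow> complex) set \<Rightarrow> (('a \<Rightarrow> complex) \<Rightarrow> real) \<Rightarrow> bool" where
  "lip_dominated S N \<longleftrightarrow> S \<subseteq> borel_measurable M \<and> (\<exists>K. \<forall>f\<in>S. lip_bound M d \<alpha> (K * N f) f) \<and>
     (\<forall>f\<in>S. \<forall>g\<in>S. (\<lambda>x. f x + g x) \<in> S) \<and> (\<forall>c. \<forall>f\<in>S. (\<lambda>x. c * f x) \<in> S)"

lemma lip_dominated_Lip: "lip_dominated Lip NLip"
  unfolding lip_dominated_def
  using Lip_space_lip_bound Lip_space_add Lip_space_cmult by (auto intro!: exI[of _ 1])

lemma lip_dominated_G: "lip_dominated G NG"
  unfolding lip_dominated_def
  using G_lip_bound G_measurable G0_add G0_cmult beta gamma by auto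

lemma atom_integrable:
  assumes "atomic_data M d p q l a" "lip_bound M d \<alpha> L f" "f \<in> borel_measurable M"
  shows "integrable M (\<lambda>x. a j x * f x)"
  using assms atom_times_lip(1)[OF _ p_pos p_le_1 q_ge_1 assms(2,3)] by (simp add: atomic_data_def)

lemmas series_summable = atomic_series_summable(1)[OF _ p_pos p_le_1 q_ge_1]

lemma atomic_series_add:
  assumes la: "atomic_data M d p q l a"
    and f: "lip_bound M d \<alpha> L f" "f \<in> borel_measurable M"
    and g: "lip_bound M d \<alpha> L' g" "g \<in> borel_measurable M"
  shows "atomic_series M l a (\<lambda>x. f x + g x) = atomic_series M l a f + atomic_series M l a g"
proof -
  have "(LINT x|M. a j x * (f x + g x)) = (LINT x|M. a j x * f x) + (LINT x|M. a j x * g x)" for j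
    unfolding distrib_left by (intro Bochner_Integration.integral_add atom_integrable[OF la f] atom_integrable[OF la g])
  then show ?thesis
    unfolding atomic_series_def
    by (simp add: distrib_left suminf_add[OF series_summable[OF la f] series_summable[OF la g]])
qed

lemma atomic_series_cmult:
  assumes la: "atomic_data M d p q l a" and f: "lip_bound M d \<alpha> L f" "f \<in> borel_measurable M"
  shows "atomic_series M l a (\<lambda>x. c * f x) = c * atomic_series M l a f"
proof -
  have "(LINT x|M. a j x * (c * f x)) = c * (LINT x|M. a j x * f x)" for j
    unfolding mult.left_commute[of _ c] by simp
  then show ?thesis
    unfolding atomic_series_def
    by (simp add: mult.left_commute[of _ c] suminf_mult[OF series_summable[OF la f]])
qed

text \<open>Every atomic series converges on S, with partial sums and limit in the dual, so weak-*
  convergence is no condition on the data. It only determines T.\<close>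

lemma weak_star_decomp_iff:
  assumes S: "lip_dominated S N"
  shows "weak_star_decomp M d p q S N T l a \<longleftrightarrow>
    atomic_data M d p q l a \<and> T = restrict (atomic_series M l a) S"
proof (cases "atomic_data M d p q l a")
  case la: True
  obtain K where lip: "\<And>f. f \<in> S \<Longrightarrow> lip_bound M d \<alpha> (K * N f) f"
    and meas: "\<And>f. f \<in> S \<Longrightarrow> f \<in> borel_measurable M"
    and add: "\<And>f g. f \<in> S \<Longrightarrow> g \<in> S \<Longrightarrow> (\<lambda>x. f x + g x) \<in> S"
    and cmult: "\<And>c f. f \<in> S \<Longrightarrow> (\<lambda>x. c * f x) \<in> S"
    using S unfolding lip_dominated_def by blast
  define B where "B = (\<Sum>j. norm (l j))"
  have partial: "functional_of M S (atomic_sum l a n) f = (\<Sum>j<n. l j * (LINT x|M. a j x * f x))"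
    if "f \<in> S" for n f
    using that atom_integrable[OF la lip meas, OF that that]
    by (simp add: functional_of_def integral_atomic_sum)
  have T: "restrict (atomic_series M l a) S \<in> cont_dual S N"
    unfolding cont_dual_def
  proof (intro CollectI conjI ballI allI exI)
    fix f assume f: "f \<in> S"
    show "norm (restrict (atomic_series M l a) S f) \<le> (B * K) * N f"
      using atomic_series_summable(2)[OF la p_pos p_le_1 q_ge_1 lip[OF f] meas[OF f]] f
      by (simp add: B_def mult.assoc atomic_series_def)
  qed (simp_all add: add cmult atomic_series_add[OF la lip meas lip meas] atomic_series_cmult[OF la lip meas])
  have F: "functional_of M S (atomic_sum l a n) \<in> cont_dual S N" for n
    unfolding cont_dual_def
  proof (intro CollectI conjI ballI allI exI)
    show "functional_of M S (atomic_sum l a n) \<in> extensional S" by (simp add: functional_of_def)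
    fix f assume f: "f \<in> S"
    show "norm (functional_of M S (atomic_sum l a n) f) \<le> (B * K) * N f"
      using atomic_series_summable(3)[OF la p_pos p_le_1 q_ge_1 lip[OF f] meas[OF f]] f
      by (simp add: B_def mult.assoc partial)
  next
    fix f g assume fg: "f \<in> S" "g \<in> S"
    have "(LINT x|M. a j x * (f x + g x)) = (LINT x|M. a j x * f x) + (LINT x|M. a j x * g x)" for j
      unfolding distrib_left using fg
      by (intro Bochner_Integration.integral_add atom_integrable[OF la lip meas])
    then show "functional_of M S (atomic_sum l a n) (\<lambda>x. f x + g x) =
        functional_of M S (atomic_sum l a n) f + functional_of M S (atomic_sum l a n) g"
      by (simp add: partial fg add distrib_left sum.distrib)
  next
    fix c f assume f: "f \<in> S"
    have "(LINT x|M. a j x * (c * f x)) = c * (LINT x|M. a j x * f x)" for j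
      unfolding mult.left_commute[of _ c] by simp
    then show "functional_of M S (atomic_sum l a n) (\<lambda>x. c * f x) =
        c * functional_of M S (atomic_sum l a n) f"
      by (simp add: partial f cmult sum_distrib_left mult.left_commute[of _ c])
  qed
  have lim: "(\<lambda>n. functional_of M S (atomic_sum l a n) f) \<longlonglongrightarrow> restrict (atomic_series M l a) S f"
    if f: "f \<in> S" for f
    using summable_LIMSEQ[OF series_summable[OF la lip[OF f] meas[OF f]]] f
    by (simp add: partial atomic_series_def)
  show ?thesis
  proof
    assume "weak_star_decomp M d p q S N T l a"
    then have "T \<in> extensional S" and lim': "\<And>f. f \<in> S \<Longrightarrow> (\<lambda>n. functional_of M S (atomic_sum l a n) f) \<longlonglongrightarrow> T f"
      by (auto simp: weak_star_decomp_def limitin_weak_star cont_dual_def)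
    then have "T = restrict (atomic_series M l a) S"
      using LIMSEQ_unique[OF lim' lim] by (intro extensionalityI[of _ S]) auto
    with la show "atomic_data M d p q l a \<and> T = restrict (atomic_series M l a) S" by blast
  next
    assume "atomic_data M d p q l a \<and> T = restrict (atomic_series M l a) S"
    then show "weak_star_decomp M d p q S N T l a"
      unfolding weak_star_decomp_def limitin_weak_star
      by (elim conjE, hypsubst) (intro conjI la T ballI lim always_eventually allI F)
  qed
qed (simp add: weak_star_decomp_def)

lemma weak_star_decomp_cont_dual:
  "weak_star_decomp M d p q S N T l a \<Longrightarrow> T \<in> cont_dual S N"
  by (simp add: weak_star_decomp_def limitin_weak_star)

lemma H_at_iff:
  "T \<in> H_at M d A0 x0 \<eta> \<beta> \<gamma> p q \<longleftrightarrow>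
    (\<exists>l a. atomic_data M d p q l a \<and> T = restrict (atomic_series M l a) G)"
  unfolding H_at_def mem_Collect_eq weak_star_decomp_iff[OF lip_dominated_G, symmetric]
  using weak_star_decomp_cont_dual by blast

lemma H_cw_iff:
  "T \<in> H_cw M d p q \<longleftrightarrow> (\<exists>l a. atomic_data M d p q l a \<and> T = restrict (atomic_series M l a) Lip)"
  unfolding H_cw_def mem_Collect_eq weak_star_decomp_iff[OF lip_dominated_Lip, symmetric]
  using weak_star_decomp_cont_dual by blast

section \<open>Uniqueness of atomic series and the case p < 1\<close>

text \<open>An application of \<open>lip_bound_induct\<close> to the property that both series
  agree. Functions constant near infinity differ from test functions by constants, which mean-zero
  atoms annihilate, and limits are covered by \<open>atomic_series_tendsto\<close>. The lattice
  argument needs real functions, so f is split into real and imaginary parts.\<close>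

lemma atomic_series_eq_if_eq_on_G:
  assumes p: "p < 1" and la: "atomic_data M d p q l a" and la': "atomic_data M d p q l' a'"
    and eq: "\<And>g. g \<in> G \<Longrightarrow> atomic_series M l a g = atomic_series M l' a' g"
    and f: "f \<in> Lip"
  shows "atomic_series M l a f = atomic_series M l' a' f"
proof -
  have \<alpha>: "0 < \<alpha>" "\<omega> * \<alpha> \<le> \<eta>" using p p_pos beta by auto
  have minus_const: "atomic_series M l a (\<lambda>x. f x - c) = atomic_series M l a f"
    if la: "atomic_data M d p q l a" and f: "lip_bound M d \<alpha> L f" "f \<in> borel_measurable M" for l a L f c
  proof -
    have "(LINT x|M. a j x * (f x - c)) = (LINT x|M. a j x * f x)" for j
    proof -
      have "hardy_atom M d p q (a j)" using la by (simp add: atomic_data_def)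
      then have "integrable M (a j)" "(LINT x|M. a j x) = 0"
        by (auto elim!: hardy_atom_L1[OF _ p_pos q_ge_1])
      then show ?thesis
        using atom_integrable[OF la f] by (simp add: right_diff_distrib)
    qed
    then show ?thesis by (simp add: atomic_series_def)
  qed
  have real: "atomic_series M l a (\<lambda>x. complex_of_real (g x)) = atomic_series M l' a' (\<lambda>x. complex_of_real (g x))"
    if g: "lip_bound M d \<alpha> L g" for g L
    using \<alpha> g
  proof (rule lip_bound_induct[of \<alpha> L g x0])
    fix h K assume h: "flat_at_infinity x0 h" "lip_bound M d \<alpha> K h"
    then obtain c where c: "bump_like x0 (\<lambda>x. h x - c)" by (auto simp: flat_at_infinity_def)
    have "(\<lambda>x. complex_of_real (h x - c)) \<in> G"
      by (intro bump_like_in_G bump_like_of_real c)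
    from eq[OF this] show "atomic_series M l a (\<lambda>x. complex_of_real (h x)) = atomic_series M l' a' (\<lambda>x. complex_of_real (h x))"
      using minus_const[OF la lip_bound_of_real[OF h(2)], of "complex_of_real c"]
        minus_const[OF la' lip_bound_of_real[OF h(2)], of "complex_of_real c"]
        lip_bound_measurable[OF lip_bound_of_real[OF h(2)] \<alpha>(1)]
      by simp
  next
    fix g :: "nat \<Rightarrow> 'a \<Rightarrow> real" and h K
    assume g: "\<And>n. lip_bound M d \<alpha> K (g n)" and lim: "\<And>x. (\<lambda>n. g n x) \<longlonglongrightarrow> h x"
      and eq_n: "\<And>n. atomic_series M l a (\<lambda>x. complex_of_real (g n x)) = atomic_series M l' a' (\<lambda>x. complex_of_real (g n x))"
    note cg = lip_bound_of_real[OF g]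
    have ch: "lip_bound M d \<alpha> K (\<lambda>x. complex_of_real (h x))"
      by (intro lip_bound_of_real lip_bound_lim[OF g lim])
    note meas = lip_bound_measurable[OF cg \<alpha>(1)] lip_bound_measurable[OF ch \<alpha>(1)]
    have "(\<lambda>n. atomic_series M l a (\<lambda>x. complex_of_real (g n x))) \<longlonglongrightarrow> atomic_series M l a (\<lambda>x. complex_of_real (h x))"
      unfolding atomic_series_def
      by (rule atomic_series_tendsto[OF la p_pos p_le_1 q_ge_1 cg meas]) (rule tendsto_of_real[OF lim])
    moreover have "(\<lambda>n. atomic_series M l' a' (\<lambda>x. complex_of_real (g n x))) \<longlonglongrightarrow> atomic_series M l' a' (\<lambda>x. complex_of_real (h x))"
      unfolding atomic_series_def
      by (rule atomic_series_tendsto[OF la' p_pos p_le_1 q_ge_1 cg meas]) (rule tendsto_of_real[OF lim])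
    ultimately show "atomic_series M l a (\<lambda>x. complex_of_real (h x)) = atomic_series M l' a' (\<lambda>x. complex_of_real (h x))"
      unfolding eq_n by (rule LIMSEQ_unique)
  qed
  note lip = Lip_space_lip_bound(2)[OF f]
  note R = lip_bound_of_real[OF lip_bound_Re[OF lip]]
  note I = lip_bound_of_real[OF lip_bound_Im[OF lip]]
  note iI = lip_bound_cmult[OF I, of \<i>]
  note mR = lip_bound_measurable[OF R \<alpha>(1)]
  note mI = lip_bound_measurable[OF I \<alpha>(1)]
  note miI = lip_bound_measurable[OF iI \<alpha>(1)]
  have split: "atomic_series M l a f = atomic_series M l a (\<lambda>x. complex_of_real (Re (f x)))
      + \<i> * atomic_series M l a (\<lambda>x. complex_of_real (Im (f x)))"
    if la: "atomic_data M d p q l a" for l a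
    using atomic_series_add[OF la R mR iI miI] atomic_series_cmult[OF la I mI, of \<i>]
    by (simp flip: complex_eq)
  show ?thesis
    unfolding split[OF la] split[OF la'] real[OF lip_bound_Re[OF lip]] real[OF lip_bound_Im[OF lip]] ..
qed

lemma restrict_G_restrict_Lip: "restrict (restrict (atomic_series M l a) Lip) G = restrict (atomic_series M l a) G"
  using G_subset_Lip by (auto simp: restrict_def fun_eq_iff)

lemma restrict_Lip_eq_if_restrict_G_eq:
  assumes "p < 1" "atomic_data M d p q l a" "atomic_data M d p q l' a'"
    and "restrict (atomic_series M l a) G = restrict (atomic_series M l' a') G"
  shows "restrict (atomic_series M l a) Lip = restrict (atomic_series M l' a') Lip"
proof (rule restrict_ext)
  have "atomic_series M l a g = atomic_series M l' a' g" if "g \<in> G" for g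
    using fun_cong[OF assms(4), of g] that by simp
  then show "atomic_series M l a f = atomic_series M l' a' f" if "f \<in> Lip" for f
    using that by (rule atomic_series_eq_if_eq_on_G[OF assms(1-3)])
qed

text \<open>Surjectivity needs no extension theorem: the data of a series on the test space already
  define a functional on the whole Lipschitz space. Injectivity is the uniqueness of series.\<close>

lemma H_cw_bij_H_at:
  assumes p: "p < 1"
  shows "bij_betw (\<lambda>T. restrict T G) (H_cw M d p q) (H_at M d A0 x0 \<eta> \<beta> \<gamma> p q)"
proof (rule bij_betw_imageI)
  show "inj_on (\<lambda>T. restrict T G) (H_cw M d p q)"
  proof (rule inj_onI)
    fix T T' assume "T \<in> H_cw M d p q" "T' \<in> H_cw M d p q" and eq: "restrict T G = restrict T' G"
    then obtain l a l' a' where "atomic_data M d p q l a" "atomic_data M d p q l' a'"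
      and T: "T = restrict (atomic_series M l a) Lip" "T' = restrict (atomic_series M l' a') Lip"
      unfolding H_cw_iff by blast
    then show "T = T'"
      using restrict_Lip_eq_if_restrict_G_eq[OF p] eq unfolding T restrict_G_restrict_Lip by blast
  qed
  show "(\<lambda>T. restrict T G) ` H_cw M d p q = H_at M d A0 x0 \<eta> \<beta> \<gamma> p q"
  proof (intro equalityI subsetI)
    fix T assume "T \<in> (\<lambda>T. restrict T G) ` H_cw M d p q"
    then obtain l a where "atomic_data M d p q l a" "T = restrict (restrict (atomic_series M l a) Lip) G"
      unfolding H_cw_iff image_iff Bex_def by blast
    then show "T \<in> H_at M d A0 x0 \<eta> \<beta> \<gamma> p q"
      unfolding H_at_iff restrict_G_restrict_Lip by blast
  next
    fix T assume "T \<in> H_at M d A0 x0 \<eta> \<beta> \<gamma> p q"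
    then obtain l a where "atomic_data M d p q l a" "T = restrict (restrict (atomic_series M l a) Lip) G"
      unfolding H_at_iff restrict_G_restrict_Lip by blast
    then show "T \<in> (\<lambda>T. restrict T G) ` H_cw M d p q" using H_cw_iff by blast
  qed
qed

text \<open>By uniqueness, data that represent the restriction also represent T, so both infima are
  taken over the same set.\<close>

lemma H_at_norm_restrict:
  assumes p: "p < 1" and T: "T \<in> H_cw M d p q"
  shows "H_at_norm M d A0 x0 \<eta> \<beta> \<gamma> p q (restrict T G) = H_cw_norm M d p q T"
proof -
  obtain l0 a0 where la0: "atomic_data M d p q l0 a0" "T = restrict (atomic_series M l0 a0) Lip"
    using T by (auto simp: H_cw_iff)
  have "weak_star_decomp M d p q G NG (restrict T G) l a \<longleftrightarrow> weak_star_decomp M d p q Lip NLip T l a" for l a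
    unfolding weak_star_decomp_iff[OF lip_dominated_G] weak_star_decomp_iff[OF lip_dominated_Lip] la0(2) restrict_G_restrict_Lip
    using restrict_Lip_eq_if_restrict_G_eq[OF p la0(1)] restrict_G_restrict_Lip by metis
  then show ?thesis unfolding H_at_norm_def H_cw_norm_def by simp
qed

section \<open>The case p = 1\<close>

lemma integrable_times_G:
  assumes f: "integrable M f" and h: "h \<in> G"
  shows "integrable M (\<lambda>x. f x * h x)"
    and "norm (LINT x|M. f x * h x) \<le> NG h * (1 / vol x0 1) * (LINT x|M. norm (f x))"
proof -
  have le: "norm (f x * h x) \<le> NG h * (1 / vol x0 1) * norm (f x)" for x
    unfolding norm_mult mult.commute[of _ "norm (f x)"] by (intro mult_left_mono G_bounded h) auto
  have i: "integrable M (\<lambda>x. NG h * (1 / vol x0 1) * norm (f x))"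
    using f by (intro integrable_mult_right integrable_norm)
  have m: "(\<lambda>x. f x * h x) \<in> borel_measurable M"
    using f G_measurable[OF h] by (intro borel_measurable_times) auto
  show int: "integrable M (\<lambda>x. f x * h x)"
    by (rule Bochner_Integration.integrable_bound[OF i m])
      (intro AE_I2 order_trans[OF le order_trans[OF abs_ge_self]], simp)
  have "norm (LINT x|M. f x * h x) \<le> (LINT x|M. NG h * (1 / vol x0 1) * norm (f x))"
    by (intro order_trans[OF integral_norm_bound] Bochner_Integration.integral_mono integrable_norm int i le)
  then show "norm (LINT x|M. f x * h x) \<le> NG h * (1 / vol x0 1) * (LINT x|M. norm (f x))" by simp
qed

lemma functional_of_eq_iff_AE:
  assumes f: "integrable M f" and g: "integrable M g"
  shows "functional_of M G f = functional_of M G g \<longleftrightarrow> (AE x in M. f x = g x)"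
proof
  assume eq: "functional_of M G f = functional_of M G g"
  have "AE x in M. f x - g x = 0"
  proof (rule AE_zero_if_bump_like_zero[of _ x0])
    show "integrable M (\<lambda>x. f x - g x)" using f g by (rule Bochner_Integration.integrable_diff)
    fix h :: "'a \<Rightarrow> complex" assume "bump_like x0 h"
    then have h: "h \<in> G" by (rule bump_like_in_G)
    note int = integrable_times_G(1)[OF _ h]
    have "(LINT x|M. f x * h x) = (LINT x|M. g x * h x)"
      using fun_cong[OF eq, of h] h by (simp add: functional_of_def)
    then show "(LINT x|M. (f x - g x) * h x) = 0"
      unfolding left_diff_distrib by (subst Bochner_Integration.integral_diff[OF int[OF f] int[OF g]]) simp
  qed
  then show "AE x in M. f x = g x" by simp
next
  assume ae: "AE x in M. f x = g x"
  have "(LINT x|M. f x * h x) = (LINT x|M. g x * h x)" if "h \<in> G" for h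
    using ae f g G_measurable[OF that]
    by (intro integral_cong_AE) (auto elim!: eventually_mono)
  then show "functional_of M G f = functional_of M G g"
    unfolding functional_of_def by (intro restrict_ext)
qed

lemma atom_integrable_1:
  assumes "p = 1" "atomic_data M d p q l a"
  shows "integrable M (a j)" "(LINT x|M. norm (a j x)) \<le> 1"
proof -
  have "hardy_atom M d 1 q (a j)" using assms by (simp add: atomic_data_def)
  then obtain x r where r: "0 < r" and i: "integrable M (a j)"
    and le: "(LINT y|M. norm (a j y)) \<le> vol x r powr (1 - 1 / 1)"
    by (rule hardy_atom_L1[OF _ zero_less_one q_ge_1]) blast
  show "integrable M (a j)" by (rule i)
  show "(LINT x|M. norm (a j x)) \<le> 1" using le vol_pos[OF r, of x] by simp
qed

lemma integrable_atomic_sum: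
  assumes "p = 1" "atomic_data M d p q l a"
  shows "integrable M (atomic_sum l a n)"
  unfolding atomic_sum_def
  by (intro Bochner_Integration.integrable_sum integrable_mult_right atom_integrable_1[OF assms])

lemma L1_decomp_exists:
  assumes p: "p = 1" and la: "atomic_data M d p q l a"
  shows "\<exists>f. integrable M f \<and> L1_decomp M d q f l a"
proof -
  have sl: "summable (\<lambda>j. norm (l j))"
    by (rule atomic_data_summable[OF la p_pos p_le_1])
  have "summable (\<lambda>j. LINT x|M. norm (l j * a j x))"
  proof (rule summable_comparison_test'[OF sl, of 0])
    fix j
    show "norm (LINT x|M. norm (l j * a j x)) \<le> norm (l j)"
      using mult_left_mono[OF atom_integrable_1(2)[OF p la, of j], of "norm (l j)"] by (simp add: norm_mult)
  qed
  from L1_series_converges[OF integrable_mult_right[OF atom_integrable_1(1)[OF p la]] this]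
  show ?thesis using la p by (simp add: L1_decomp_def atomic_sum_def)
qed

text \<open>Test functions are bounded, so L1 convergence of the partial sums implies convergence of
  their pairings, whose limit is the series.\<close>

lemma L1_decomp_functional_of:
  assumes p: "p = 1" and f: "integrable M f" and dec: "L1_decomp M d q f l a"
  shows "atomic_data M d p q l a" "functional_of M G f = restrict (atomic_series M l a) G"
proof -
  show la: "atomic_data M d p q l a" using dec p by (simp add: L1_decomp_def)
  have "(LINT x|M. f x * g x) = atomic_series M l a g" if g: "g \<in> G" for g
  proof (rule LIMSEQ_unique)
    have lim0: "(\<lambda>n. NG g * (1 / vol x0 1) * (LINT x|M. norm (f x - atomic_sum l a n x))) \<longlonglongrightarrow> 0"
      using tendsto_mult_left[OF conjunct2[OF dec[unfolded L1_decomp_def]], of "NG g * (1 / vol x0 1)"] by simp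
    have "\<forall>n. norm (LINT x|M. (f x - atomic_sum l a n x) * g x)
        \<le> NG g * (1 / vol x0 1) * (LINT x|M. norm (f x - atomic_sum l a n x))"
      by (intro allI integrable_times_G(2) Bochner_Integration.integrable_diff f integrable_atomic_sum p la g)
    then have "(\<lambda>n. LINT x|M. (f x - atomic_sum l a n x) * g x) \<longlonglongrightarrow> 0"
      by (rule Lim_null_comparison[OF always_eventually lim0])
    then have "(\<lambda>n. (LINT x|M. f x * g x) - (LINT x|M. atomic_sum l a n x * g x)) \<longlonglongrightarrow> 0"
      unfolding left_diff_distrib
        Bochner_Integration.integral_diff[OF integrable_times_G(1)[OF f g] integrable_times_G(1)[OF integrable_atomic_sum[OF p la] g]] .
    from tendsto_diff[OF tendsto_const[of "LINT x|M. f x * g x"] this]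
    show "(\<lambda>n. LINT x|M. atomic_sum l a n x * g x) \<longlonglongrightarrow> (LINT x|M. f x * g x)" by simp
    obtain L where "lip_bound M d \<alpha> L g" using G_lip_bound g by blast
    then show "(\<lambda>n. LINT x|M. atomic_sum l a n x * g x) \<longlonglongrightarrow> atomic_series M l a g"
      unfolding integral_atomic_sum[OF integrable_times_G(1)[OF atom_integrable_1(1)[OF p la] g]] atomic_series_def
      by (intro summable_LIMSEQ series_summable[OF la _ G_measurable[OF g]])
  qed
  then show "functional_of M G f = restrict (atomic_series M l a) G"
    unfolding functional_of_def by (intro restrict_ext)
qed

text \<open>For the converse, the series converges in L1 to some g. Both f and g induce the same
  functional on test functions, hence agree almost everywhere, and f inherits the L1
  convergence.\<close>

lemma L1_decomp_iff_weak_star_decomp: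
  assumes p: "p = 1" and f: "integrable M f"
  shows "L1_decomp M d q f l a \<longleftrightarrow> weak_star_decomp M d p q G NG (functional_of M G f) l a"
  unfolding weak_star_decomp_iff[OF lip_dominated_G]
proof
  assume "L1_decomp M d q f l a"
  then show "atomic_data M d p q l a \<and> functional_of M G f = restrict (atomic_series M l a) G"
    using L1_decomp_functional_of[OF p f] by blast
next
  assume *: "atomic_data M d p q l a \<and> functional_of M G f = restrict (atomic_series M l a) G"
  then obtain g where g: "integrable M g" "L1_decomp M d q g l a"
    using L1_decomp_exists[OF p] by blast
  have "functional_of M G f = functional_of M G g" using * L1_decomp_functional_of(2)[OF p g] by simp
  then have AE: "AE x in M. f x = g x" by (simp add: functional_of_eq_iff_AE[OF f g(1)])
  have m: "f \<in> borel_measurable M" "g \<in> borel_measurable M" "atomic_sum l a n \<in> borel_measurable M" for n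
    using f g(1) integrable_atomic_sum[OF p, of l a n] * by auto
  have "(LINT x|M. norm (f x - atomic_sum l a n x)) = (LINT x|M. norm (g x - atomic_sum l a n x))" for n
    using m AE by (intro integral_cong_AE borel_measurable_norm borel_measurable_diff) (auto elim!: eventually_mono)
  with g(2) show "L1_decomp M d q f l a" by (simp add: L1_decomp_def)
qed

lemma functional_of_H_cw1:
  assumes p: "p = 1"
  shows "functional_of M G ` H_cw1 M d q = H_at M d A0 x0 \<eta> \<beta> \<gamma> p q"
proof (intro equalityI subsetI)
  fix T assume "T \<in> functional_of M G ` H_cw1 M d q"
  then obtain f l a where "T = functional_of M G f" "integrable M f" "L1_decomp M d q f l a"
    unfolding H_cw1_def by auto
  with L1_decomp_functional_of[OF p this(2,3)] show "T \<in> H_at M d A0 x0 \<eta> \<beta> \<gamma> p q"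
    unfolding H_at_iff by (intro exI[of _ l] exI[of _ a]) simp
next
  fix T assume "T \<in> H_at M d A0 x0 \<eta> \<beta> \<gamma> p q"
  then obtain l a where la: "atomic_data M d p q l a" and T: "T = restrict (atomic_series M l a) G"
    unfolding H_at_iff by blast
  obtain f where f: "integrable M f" "L1_decomp M d q f l a" using L1_decomp_exists[OF p la] by blast
  then have "f \<in> H_cw1 M d q" by (auto simp: H_cw1_def)
  moreover have "T = functional_of M G f" using L1_decomp_functional_of(2)[OF p f] T by simp
  ultimately show "T \<in> functional_of M G ` H_cw1 M d q" by blast
qed

lemma H_at_norm_functional_of:
  assumes "p = 1" "f \<in> H_cw1 M d q"
  shows "H_at_norm M d A0 x0 \<eta> \<beta> \<gamma> p q (functional_of M G f) = H_cw1_norm M d q f"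
  using L1_decomp_iff_weak_star_decomp[OF assms(1), of f] assms
  by (simp add: H_at_norm_def H_cw1_norm_def H_cw1_def)

end

text \<open>For p = 1 the elements of \<open>H_cw1\<close> are functions rather than classes, so
  injectivity of the identification takes the form of equality almost everywhere.\<close>

theorem theorem4p16:
  fixes M :: "'a::topological_space measure"
    and d :: "'a \<Rightarrow> 'a \<Rightarrow> real"
    and A0 Cmu \<delta> c0 C0 \<eta> p \<beta> \<gamma> :: real
    and A :: "int \<Rightarrow> 'i set" and z :: "int \<Rightarrow> 'i \<Rightarrow> 'a"
    and x0 :: 'a
    and q :: ennreal
  assumes "homogeneous_type M d A0 Cmu"
    and "dyadic_points d A0 \<delta> c0 C0 A z"
    and "smoothness_index M d A0 \<delta> A z \<eta>"
    and "upper_dim Cmu / (upper_dim Cmu + \<eta>) < p" and "p \<le> 1"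
    and "ennreal p < q" and "1 \<le> q"
    and "upper_dim Cmu * (1 / p - 1) < \<beta>" and "\<beta> < \<eta>"
    and "upper_dim Cmu * (1 / p - 1) < \<gamma>" and "\<gamma> < \<eta>"
  shows "(p < 1 \<longrightarrow>
            bij_betw (\<lambda>T. restrict T (G0 M d A0 x0 \<eta> \<beta> \<gamma>))
              (H_cw M d p q) (H_at M d A0 x0 \<eta> \<beta> \<gamma> p q) \<and>
            (\<forall>T\<in>H_cw M d p q.
               H_at_norm M d A0 x0 \<eta> \<beta> \<gamma> p q (restrict T (G0 M d A0 x0 \<eta> \<beta> \<gamma>))
                 = H_cw_norm M d p q T))
       \<and> (p = 1 \<longrightarrow>
            functional_of M (G0 M d A0 x0 \<eta> \<beta> \<gamma>) ` H_cw1 M d q = H_at M d A0 x0 \<eta> \<beta> \<gamma> p q \<and>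
            (\<forall>f\<in>H_cw1 M d q. \<forall>g\<in>H_cw1 M d q.
               functional_of M (G0 M d A0 x0 \<eta> \<beta> \<gamma>) f = functional_of M (G0 M d A0 x0 \<eta> \<beta> \<gamma>) g
                 \<longleftrightarrow> (AE x in M. f x = g x)) \<and>
            (\<forall>f\<in>H_cw1 M d q.
               H_at_norm M d A0 x0 \<eta> \<beta> \<gamma> p q (functional_of M (G0 M d A0 x0 \<eta> \<beta> \<gamma>) f)
                 = H_cw1_norm M d q f))"
proof -
  interpret hardy_parameters M d A0 Cmu \<delta> c0 C0 A z \<eta> p \<beta> \<gamma> x0 q
    using assms
    by (auto intro!: hardy_parameters.intro hardy_parameters_axioms.intro smooth_homogeneous_type.intro)
  show ?thesis
  proof (intro conjI impI ballI)
    fix f g assume "f \<in> H_cw1 M d q" "g \<in> H_cw1 M d q"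
    then show "functional_of M G f = functional_of M G g \<longleftrightarrow> (AE x in M. f x = g x)"
      by (intro functional_of_eq_iff_AE) (simp_all add: H_cw1_def)
  qed (rule H_cw_bij_H_at H_at_norm_restrict functional_of_H_cw1 H_at_norm_functional_of; assumption)+
qed

end
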